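(* The linear system: find $(w,\phi)\in H_{per}(\Omega)\times H_{per}(\Omega)$ such that $$(\phi,\mu)+\delta t\,M(\nabla w,\nabla\mu)=(\widehat\phi^n,\mu)\qquad\text{for all }\mu\in H_{per}(\Omega),$$ $$(-w,\psi)+\epsilon^2(\nabla\phi,\nabla\psi)+\tfrac12(H^n\phi,H^n\psi)=\big(-H^nU^n+\tfrac12H^nH^n\widehat\phi^n,\psi\big)\qquad\text{for all }\psi\in H_{per}(\Omega),$$ admits a unique solution $(w,\phi)$ in $H_{per}(\Omega)\times H_{per}(\Omega)$.
   Context: $\Omega\subset\mathbb R^d$ ($d=2,3$) is a rectangular box (periodic cell). $(\cdot,\cdot)$ is the $L^2(\Omega)$ inner product, and $$H_{per}(\Omega)=\Big\{\phi\in H^1(\Omega):\ \phi\text{ is periodic and }\int_\Omega\phi\,d\boldsymbol x=0\Big\}.$$ $M>0$, $\epsilon>0$, $\delta t>0$ are constants. $F$ is a $C^1$ potential with $F>-A$ on its domain ($A>0$ a constant), $B>A$ is a constant, $f=F'$, $H(\phi)=f(\phi)/\sqrt{F(\phi)+B}$. The functions $\phi^n$ and $U^n$ are given (from the previous time step), with $\phi^n\in H^1(\Omega)$ periodic, $U^n\in L^2(\Omega)$, and $H^n=H(\phi^n)\in L^\infty(\Omega)$. Moreover $\widehat\phi^n=\phi^n-V_\phi$, where $V_\phi=\frac1{|\Omega|}\int_\Omega\phi^0\,d\boldsymbol x=\frac1{|\Omega|}\int_\Omega\phi^n\,d\boldsymbol x$ (the scheme conserves the mean of $\phi$), so that $\widehat\phi^n\in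 H_{per}(\Omega)$. *)

theory Defs
  imports "HOL-Analysis.Analysis"
begin

section \<open>Lebesgue spaces\<close>

text \<open>Elements of function spaces are represented by functions; the a.e. classes of the
  mathematics appear as the relation \<open>AE x in lebesgue_on S\<close>.\<close>

definition L2 :: "(real^'d) set \<Rightarrow> (real^'d \<Rightarrow> 'b::euclidean_space) set" where
  "L2 S = {u. u \<in> borel_measurable (lebesgue_on S) \<and>
              integrable (lebesgue_on S) (\<lambda>x. (norm (u x))\<^sup>2)}"

definition L2loc :: "(real^'d) set \<Rightarrow> (real^'d \<Rightarrow> 'b::euclidean_space) set" where
  "L2loc S = {u. \<forall>K. compact K \<and> K \<subseteq> S \<longrightarrow> u \<in> L2 K}"

definition Linf :: "(real^'d) set \<Rightarrow> (real^'d \<Rightarrow> real) set" where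
  "Linf S = {u. u \<in> borel_measurable (lebesgue_on S) \<and>
                (\<exists>C. AE x in lebesgue_on S. \<bar>u x\<bar> \<le> C)}"

definition L2_inner :: "(real^'d) set \<Rightarrow> (real^'d \<Rightarrow> 'b::euclidean_space) \<Rightarrow> (real^'d \<Rightarrow> 'b) \<Rightarrow> real"
  where "L2_inner S u v = (\<integral>x. u x \<bullet> v x \<partial>(lebesgue_on S))"

definition mean_value :: "(real^'d) set \<Rightarrow> (real^'d \<Rightarrow> real) \<Rightarrow> real" where
  "mean_value S u = (\<integral>x. u x \<partial>(lebesgue_on S)) / measure lebesgue S"


section \<open>Weak gradients and \<open>H\<^sup>1\<close>\<close>

definition partial_deriv :: "'d \<Rightarrow> (real^'d \<Rightarrow> real) \<Rightarrow> real^'d \<Rightarrow> real" where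
  "partial_deriv i \<eta> x = frechet_derivative \<eta> (at x) (axis i 1)"

primrec Ck :: "nat \<Rightarrow> (real^'d \<Rightarrow> real) \<Rightarrow> bool" where
  "Ck 0 \<eta> \<longleftrightarrow> continuous_on UNIV \<eta>"
| "Ck (Suc k) \<eta> \<longleftrightarrow> (\<forall>x. \<eta> differentiable (at x)) \<and> (\<forall>i. Ck k (partial_deriv i \<eta>))"

definition test_functions :: "(real^'d) set \<Rightarrow> (real^'d \<Rightarrow> real) set" where
  "test_functions S = {\<eta>. (\<forall>k. Ck k \<eta>) \<and>
     compact (closure {x. \<eta> x \<noteq> 0}) \<and> closure {x. \<eta> x \<noteq> 0} \<subseteq> S}"

text \<open>Only meaningful for open \<open>S\<close> and locally integrable \<open>u\<close> and \<open>g\<close>; the uses below impose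
  (local) square integrability.\<close>

definition has_weak_gradient ::
    "(real^'d) set \<Rightarrow> (real^'d \<Rightarrow> real) \<Rightarrow> (real^'d \<Rightarrow> real^'d) \<Rightarrow> bool" where
  "has_weak_gradient S u g \<longleftrightarrow> (\<forall>\<eta>\<in>test_functions S. \<forall>i.
     (\<integral>x. u x * partial_deriv i \<eta> x \<partial>(lebesgue_on S)) =
     - (\<integral>x. g x $ i * \<eta> x \<partial>(lebesgue_on S)))"

definition H1 :: "(real^'d) set \<Rightarrow> (real^'d \<Rightarrow> real) set" where
  "H1 S = {u \<in> L2 S. \<exists>g\<in>L2 S. has_weak_gradient S u g}"

definition H1loc :: "(real^'d) set \<Rightarrow> (real^'d \<Rightarrow> real) set" where
  "H1loc S = {u \<in> L2loc S. \<exists>g\<in>L2loc S. has_weak_gradient S u g}"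

text \<open>The weak gradient is determined only almost everywhere, so this picks a representative.\<close>

definition weak_grad :: "(real^'d) set \<Rightarrow> (real^'d \<Rightarrow> real) \<Rightarrow> real^'d \<Rightarrow> real^'d" where
  "weak_grad S u = (SOME g. g \<in> L2 S \<and> has_weak_gradient S u g)"


section \<open>Periodic functions on a box\<close>

definition box_periodic :: "real^'d \<Rightarrow> real^'d \<Rightarrow> (real^'d \<Rightarrow> real) \<Rightarrow> bool" where
  "box_periodic a b v \<longleftrightarrow> (\<forall>x i. v (x + axis i (b $ i - a $ i)) = v x)"

text \<open>An \<open>H\<^sup>1\<close> function on the box is periodic (i.e. its traces on opposite faces agree) if its
  periodic extension to the whole space is locally \<open>H\<^sup>1\<close>. Point values on the
  faces are irrelevant, hence the extension only has to agree with \<open>u\<close> a.e. in the box.\<close>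

definition H1_periodic :: "real^'d \<Rightarrow> real^'d \<Rightarrow> (real^'d \<Rightarrow> real) set" where
  "H1_periodic a b = {u \<in> H1 (box a b).
     \<exists>v \<in> H1loc UNIV. box_periodic a b v \<and> (AE x in lebesgue_on (box a b). v x = u x)}"

definition H_per :: "real^'d \<Rightarrow> real^'d \<Rightarrow> (real^'d \<Rightarrow> real) set" where
  "H_per a b = {u \<in> H1_periodic a b. (\<integral>x. u x \<partial>(lebesgue_on (box a b))) = 0}"


section \<open>The linear system\<close>

definition H_fun :: "(real \<Rightarrow> real) \<Rightarrow> (real \<Rightarrow> real) \<Rightarrow> real \<Rightarrow> real \<Rightarrow> real" where
  "H_fun F f B s = f s / sqrt (F s + B)"

text \<open>\<open>h\<close>, \<open>U\<close> and \<open>\<phi>h\<close> are \<open>H\<^sup>n\<close>, \<open>U\<^sup>n\<close> and the mean-free part of \<open>\<phi>\<^sup>n\<close>.\<close>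

definition solves_system ::
    "real^'d \<Rightarrow> real^'d \<Rightarrow> real \<Rightarrow> real \<Rightarrow> real \<Rightarrow> (real^'d \<Rightarrow> real) \<Rightarrow> (real^'d \<Rightarrow> real) \<Rightarrow>
     (real^'d \<Rightarrow> real) \<Rightarrow> (real^'d \<Rightarrow> real) \<Rightarrow> (real^'d \<Rightarrow> real) \<Rightarrow> bool" where
  "solves_system a b M \<epsilon> \<delta>t h U \<phi>h w \<phi> \<longleftrightarrow>
     w \<in> H_per a b \<and> \<phi> \<in> H_per a b \<and>
     (\<forall>\<mu>\<in>H_per a b.
        L2_inner (box a b) \<phi> \<mu>
        + \<delta>t * M * L2_inner (box a b) (weak_grad (box a b) w) (weak_grad (box a b) \<mu>)
        = L2_inner (box a b) \<phi>h \<mu>) \<and>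
     (\<forall>\<psi>\<in>H_per a b.
        L2_inner (box a b) (\<lambda>x. - w x) \<psi>
        + \<epsilon>\<^sup>2 * L2_inner (box a b) (weak_grad (box a b) \<phi>) (weak_grad (box a b) \<psi>)
        + 1 / 2 * L2_inner (box a b) (\<lambda>x. h x * \<phi> x) (\<lambda>x. h x * \<psi> x)
        = L2_inner (box a b) (\<lambda>x. - h x * U x + 1 / 2 * h x * h x * \<phi>h x) \<psi>)"

end

theory Submission
  imports Defs "HOL-Library.Function_Algebras"
begin

text \<open>
  The sum of the two equations is a variational problem on pairs of periodic mean-free functions:
  find \<open>(w, \<phi>)\<close> with \<open>b((w, \<phi>), (\<mu>, \<psi>)) = l(\<mu>, \<psi>)\<close> for all \<open>(\<mu>, \<psi>)\<close>, where
  \<open>b = (\<phi>, \<mu>) + \<delta>t M (\<nabla>w, \<nabla>\<mu>) - (w, \<psi>) + \<epsilon>\<^sup>2 (\<nabla>\<phi>, \<nabla>\<psi>) + 1/2 (H \<phi>, H \<psi>)\<close>.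
  On the diagonal the two coupling terms cancel and only gradients and the weighted term remain, so
  \<open>b\<close> is not obviously coercive in the \<open>H\<^sup>1\<close> norm. The usual way out is the Poincare inequality;
  here the coupling terms themselves supply the missing \<open>L\<^sup>2\<close> norms. For \<open>(w, \<phi>) = (\<mu> - t \<psi>, \<psi> + t \<mu>)\<close>
  they contribute \<open>t (\<bar>\<mu>\<bar>\<^sup>2 + \<bar>\<psi>\<bar>\<^sup>2)\<close>, and for small \<open>t\<close> the new cross terms are absorbed by the
  gradients and by these squares. This is an inf-sup condition (\<open>form_inf_sup\<close>), and on a complete
  space an inf-sup condition in this one direction already gives existence (\<open>inf_sup_solvable\<close>):
  the adjoint \<open>S\<close> of the operator of \<open>b\<close> is bounded below, so the inner product of \<open>S x\<close> and \<open>S y\<close>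
  is again complete, Riesz represents \<open>l\<close> by some \<open>z\<close> in it, and \<open>S z\<close> solves the problem.

  Uniqueness is shorter: if the data vanish, testing with the solution kills all the gradients and
  \<open>H \<phi>\<close>, and then testing the first equation with \<open>\<phi>\<close> and the second with \<open>w\<close> leaves
  \<open>(\<phi>, \<phi>) = 0\<close> and \<open>(w, w) = 0\<close>.

  What remains is that the periodic mean-free functions are a complete inner product space for
  the \<open>H\<^sup>1\<close> inner product (\<open>energy_complete\<close>). Two facts carry this. First, the chosen weak gradient
  is linear almost everywhere, because weak gradients are unique almost everywhere
  (\<open>weak_gradient_unique\<close>); by the fundamental lemma of the calculus of variations this comes down
  to approximating the indicators of boxes by smooth functions of compact support. Second,
  periodicity survives \<open>L\<^sup>2\<close> limits: \<open>u\<close> is a periodic \<open>H\<^sup>1\<close> function with gradient \<open>g\<close> precisely if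
  the periodic extension of \<open>g\<close> is a weak gradient of the periodic extension of \<open>u\<close> on the whole
  space (\<open>weak_gradient_periodic_ext\<close>, \<open>H1_periodicI\<close>), and on any compact set the \<open>L\<^sup>2\<close> norm of a
  periodic extension is controlled by the norm on the cell (\<open>periodic_ext_L2\<close>), so that this
  relation passes to the limit.
\<close>


section \<open>Complete semi-inner products and the inf-sup theorem\<close>

text \<open>Elements of the function spaces are functions, not classes; with the pointwise vector space
  structure the spaces become subspaces, and the norms become seminorms.\<close>
instantiation "fun" :: (type, real_vector) real_vector
begin

definition "r *\<^sub>R f = (\<lambda>x. r *\<^sub>R f x)"

instance
  by standard (simp_all add: scaleR_fun_def fun_eq_iff algebra_simps)

end

lemma scaleR_fun_apply [simp]: "(r *\<^sub>R f) x = r *\<^sub>R f x"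
  by (simp add: scaleR_fun_def)

text \<open>Bilinearity is only demanded on a subspace, since the integrals involved are additive only
  for square-integrable functions.\<close>
locale bilinear_on =
  fixes V :: "'v::real_vector set" and bl :: "'v \<Rightarrow> 'v \<Rightarrow> real"
  assumes subspace: "subspace V"
    and add_left: "\<lbrakk>x \<in> V; y \<in> V; z \<in> V\<rbrakk> \<Longrightarrow> bl (x + y) z = bl x z + bl y z"
    and scale_left: "\<lbrakk>x \<in> V; z \<in> V\<rbrakk> \<Longrightarrow> bl (r *\<^sub>R x) z = r * bl x z"
    and add_right: "\<lbrakk>x \<in> V; y \<in> V; z \<in> V\<rbrakk> \<Longrightarrow> bl z (x + y) = bl z x + bl z y"
    and scale_right: "\<lbrakk>x \<in> V; z \<in> V\<rbrakk> \<Longrightarrow> bl z (r *\<^sub>R x) = r * bl z x"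
begin

lemma subspace_closed [simp]:
  "0 \<in> V" "\<lbrakk>x \<in> V; y \<in> V\<rbrakk> \<Longrightarrow> x + y \<in> V" "\<lbrakk>x \<in> V; y \<in> V\<rbrakk> \<Longrightarrow> x - y \<in> V"
  "x \<in> V \<Longrightarrow> r *\<^sub>R x \<in> V"
  using subspace by (auto simp: subspace_0 subspace_add subspace_diff subspace_scale)

lemma diff_left: "\<lbrakk>x \<in> V; y \<in> V; z \<in> V\<rbrakk> \<Longrightarrow> bl (x - y) z = bl x z - bl y z"
  using add_left[of x "-1 *\<^sub>R y" z] scale_left[of y z "-1"] subspace_closed(4)[of y "-1"] by simp

lemma diff_right: "\<lbrakk>x \<in> V; y \<in> V; z \<in> V\<rbrakk> \<Longrightarrow> bl z (x - y) = bl z x - bl z y"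
  using add_right[of x "-1 *\<^sub>R y" z] scale_right[of y z "-1"] subspace_closed(4)[of y "-1"] by simp

lemmas bilin = add_left scale_left add_right scale_right diff_left diff_right

end

text \<open>Definiteness is left out on purpose: functions that vanish almost everywhere have norm zero.
  Limits and solutions are therefore determined only up to norm zero.\<close>
locale semi_inner_product = bilinear_on V ip
  for V :: "'v::real_vector set" and ip :: "'v \<Rightarrow> 'v \<Rightarrow> real" +
  assumes sym: "\<lbrakk>x \<in> V; y \<in> V\<rbrakk> \<Longrightarrow> ip x y = ip y x"
    and nonneg: "x \<in> V \<Longrightarrow> 0 \<le> ip x x"
begin

definition nrm :: "'v \<Rightarrow> real" where "nrm x = sqrt (ip x x)"

lemma nrm_nonneg [simp]: "x \<in> V \<Longrightarrow> 0 \<le> nrm x"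
  by (simp add: nrm_def nonneg)

lemma nrm_sq: "x \<in> V \<Longrightarrow> (nrm x)\<^sup>2 = ip x x"
  by (simp add: nrm_def nonneg)

lemma Cauchy_Schwarz:
  assumes x: "x \<in> V" and y: "y \<in> V"
  shows "\<bar>ip x y\<bar> \<le> nrm x * nrm y"
proof -
  have q: "0 \<le> ip x x + 2 * t * ip x y + t\<^sup>2 * ip y y" for t
  proof -
    have "0 \<le> ip (x + t *\<^sub>R y) (x + t *\<^sub>R y)"
      using x y by (intro nonneg) simp
    also have "\<dots> = ip x x + 2 * t * ip x y + t\<^sup>2 * ip y y"
      using x y sym[of x y] by (simp add: bilin power2_eq_square algebra_simps)
    finally show ?thesis .
  qed
  have "(ip x y)\<^sup>2 \<le> ip x x * ip y y"
  proof (cases "ip y y = 0")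
    case True
    have "ip x y = 0"
    proof (rule ccontr)
      assume n: "ip x y \<noteq> 0"
      then have "2 * (- (ip x x + 1) / (2 * ip x y)) * ip x y = - (ip x x + 1)"
        by simp
      then show False
        using q[of "- (ip x x + 1) / (2 * ip x y)"] True by simp
    qed
    then show ?thesis using True by simp
  next
    case False
    then have p: "ip y y > 0" using nonneg[OF y] by simp
    have "0 \<le> (ip x x + 2 * (- ip x y / ip y y) * ip x y + (- ip x y / ip y y)\<^sup>2 * ip y y) * ip y y"
      using q[of "- ip x y / ip y y"] p by (intro mult_nonneg_nonneg) auto
    also have "\<dots> = ip x x * ip y y - (ip x y)\<^sup>2"
      using p by (simp add: field_simps power2_eq_square)
    finally show ?thesis by simp
  qed
  then have "sqrt ((ip x y)\<^sup>2) \<le> sqrt (ip x x * ip y y)"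
    by (rule real_sqrt_le_mono)
  then show ?thesis
    by (simp add: nrm_def real_sqrt_mult)
qed

lemma ip_tendsto:
  assumes X: "\<And>n. X n \<in> V" and x: "x \<in> V" and y: "y \<in> V"
    and lim: "(\<lambda>n. ip (X n - x) (X n - x)) \<longlonglongrightarrow> 0"
  shows "(\<lambda>n. ip (X n) y) \<longlonglongrightarrow> ip x y"
proof (rule LIM_zero_cancel, rule Lim_null_comparison)
  show "\<forall>\<^sub>F n in sequentially. norm (ip (X n) y - ip x y) \<le> sqrt (ip (X n - x) (X n - x)) * nrm y"
    using Cauchy_Schwarz[of "X _ - x" y] X x y
    by (intro always_eventually allI) (simp add: bilin nrm_def[of "X _ - x"])
  show "(\<lambda>n. sqrt (ip (X n - x) (X n - x)) * nrm y) \<longlonglongrightarrow> 0"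
    using tendsto_mult_left_zero[OF tendsto_real_sqrt[OF lim, simplified]] by simp
qed

end

locale complete_semi_inner_product = semi_inner_product V ip
  for V :: "'v::real_vector set" and ip :: "'v \<Rightarrow> 'v \<Rightarrow> real" +
  assumes complete: "\<lbrakk>\<And>n. X n \<in> V; \<And>e. e > 0 \<Longrightarrow> \<exists>N. \<forall>m\<ge>N. \<forall>n\<ge>N. ip (X m - X n) (X m - X n) < e\<rbrakk>
      \<Longrightarrow> \<exists>x\<in>V. (\<lambda>n. ip (X n - x) (X n - x)) \<longlonglongrightarrow> 0"
begin

text \<open>The representing vector minimises \<open>ip x x - 2 * l x\<close>. By the parallelogram law every
  minimising sequence is Cauchy, so completeness provides a minimiser, and the first variation at
  it is the required identity.\<close>
theorem Riesz_representation:
  assumes add: "\<And>x y. \<lbrakk>x \<in> V; y \<in> V\<rbrakk> \<Longrightarrow> l (x + y) = l x + l y"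
    and scale: "\<And>x r. x \<in> V \<Longrightarrow> l (r *\<^sub>R x) = r * l x"
    and bound: "\<And>x. x \<in> V \<Longrightarrow> \<bar>l x\<bar> \<le> C * nrm x"
  shows "\<exists>x\<in>V. \<forall>y\<in>V. ip x y = l y"
proof -
  define J where "J x = ip x x - 2 * l x" for x
  have lower: "- (C\<^sup>2) \<le> J x" if "x \<in> V" for x
  proof -
    have "0 \<le> (nrm x - C)\<^sup>2" by simp
    also have "\<dots> = ip x x - 2 * (C * nrm x) + C\<^sup>2"
      using nrm_sq[OF that] by (simp add: power2_diff)
    also have "\<dots> \<le> J x + C\<^sup>2"
      using bound[OF that] by (simp add: J_def abs_le_iff)
    finally show ?thesis by simp
  qed
  define m where "m = Inf (J ` V)"
  have bdd: "bdd_below (J ` V)"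
    using lower by (auto intro!: bdd_belowI)
  have m_le: "m \<le> J x" if "x \<in> V" for x
    unfolding m_def using bdd that by (simp add: cInf_lower)
  have "\<exists>x\<in>V. J x < m + 1 / Suc n" for n
  proof -
    have "\<exists>y\<in>J ` V. y < m + 1 / Suc n"
      unfolding m_def by (rule cInf_lessD) (use subspace_closed(1) in blast, simp)
    then show ?thesis by auto
  qed
  then obtain X where X: "\<And>n. X n \<in> V" and JX: "\<And>n. J (X n) < m + 1 / Suc n"
    by metis
  \<comment> \<open>The parallelogram law: the midpoint of two near-minimisers cannot go below \<open>m\<close>.\<close>
  have para: "ip (x - y) (x - y) \<le> 2 * (J x - m) + 2 * (J y - m)" if "x \<in> V" "y \<in> V" for x y
  proof -
    have "J ((1/2) *\<^sub>R (x + y)) = ip (x + y) (x + y) / 4 - (l x + l y)"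
      using that by (simp add: J_def bilin scale add field_simps)
    then have "4 * m \<le> ip (x + y) (x + y) - 4 * (l x + l y)"
      using m_le[of "(1/2) *\<^sub>R (x + y)"] that by simp
    then show ?thesis
      using that sym[of x y] by (simp add: J_def bilin)
  qed
  have "\<exists>x\<in>V. (\<lambda>n. ip (X n - x) (X n - x)) \<longlonglongrightarrow> 0"
  proof (rule complete[OF X])
    fix e :: real assume "e > 0"
    then obtain N where N: "4 / Suc N < e"
      using reals_Archimedean[of "e / 4"] by (auto simp: field_simps inverse_eq_divide)
    have "ip (X i - X j) (X i - X j) < e" if "i \<ge> N" "j \<ge> N" for i j
    proof -
      have "1 / real (Suc i) \<le> 1 / real (Suc N)" "1 / real (Suc j) \<le> 1 / real (Suc N)"
        using that by (auto intro!: divide_left_mono)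
      then show ?thesis
        using para[OF X[of i] X[of j]] JX[of i] JX[of j] N by simp
    qed
    then show "\<exists>N. \<forall>m\<ge>N. \<forall>n\<ge>N. ip (X m - X n) (X m - X n) < e" by blast
  qed
  then obtain x where x: "x \<in> V" and lim: "(\<lambda>n. ip (X n - x) (X n - x)) \<longlonglongrightarrow> 0" by blast
  have limn: "(\<lambda>n. nrm (X n - x)) \<longlonglongrightarrow> 0"
    unfolding nrm_def using tendsto_real_sqrt[OF lim] by simp
  have "J x \<le> J (X n) + 2 * (nrm x + C) * nrm (X n - x)" for n
  proof -
    have "J (X n) = J x + 2 * ip x (X n - x) + ip (X n - x) (X n - x) - 2 * l (X n - x)"
    proof -
      have "J (x + h) = J x + 2 * ip x h + ip h h - 2 * l h" if "h \<in> V" for h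
        using x that sym[of x h] by (simp add: J_def bilin add)
      from this[of "X n - x"] show ?thesis
        using x X[of n] by simp
    qed
    moreover have "\<bar>ip x (X n - x)\<bar> \<le> nrm x * nrm (X n - x)"
      using x X by (intro Cauchy_Schwarz) auto
    moreover have "\<bar>l (X n - x)\<bar> \<le> C * nrm (X n - x)"
      using x X by (intro bound) auto
    moreover have "0 \<le> ip (X n - x) (X n - x)"
      using x X by (intro nonneg) auto
    ultimately show ?thesis by (simp add: algebra_simps abs_le_iff)
  qed
  then have ub: "J x \<le> (m + 1 / Suc n) + 2 * (nrm x + C) * nrm (X n - x)" for n
    using JX[of n] by (meson add_mono less_imp_le order.refl order_trans)
  have "(\<lambda>n. (m + 1 / Suc n) + 2 * (nrm x + C) * nrm (X n - x)) \<longlonglongrightarrow> (m + 0) + 2 * (nrm x + C) * 0"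
    by (intro tendsto_intros limn LIMSEQ_Suc[OF lim_1_over_n])
  then have Jx: "J x \<le> m"
    using ub by (intro LIMSEQ_le_const) auto
  have "ip x y = l y" if y: "y \<in> V" for y
  proof -
    have var: "0 \<le> 2 * t * (ip x y - l y) + t\<^sup>2 * ip y y" for t
    proof -
      have "J x \<le> J (x + t *\<^sub>R y)"
        using Jx m_le[of "x + t *\<^sub>R y"] x y by simp
      then show ?thesis
        using x y sym[of x y] by (simp add: J_def bilin add scale power2_eq_square algebra_simps)
    qed
    define d where "d = ip x y - l y"
    \<comment> \<open>The parabola in \<open>t\<close> is tested near its vertex; the summand 1 guards against \<open>ip y y = 0\<close>.\<close>
    define s where "s = 1 / (1 + ip y y)"
    have yy: "0 \<le> ip y y" using y by (rule nonneg)
    then have s: "s > 0" "s * (1 + ip y y) = 1" by (auto simp: s_def)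
    have "0 \<le> 2 * (- s * d) * d + (- s * d)\<^sup>2 * ip y y"
      using var[of "- s * d"] by (simp add: d_def)
    also have "\<dots> = s * d\<^sup>2 * (s * ip y y - 2)"
      by (simp add: power2_eq_square algebra_simps)
    finally have "0 \<le> s * d\<^sup>2 * (s * ip y y - 2)" .
    moreover have "s * ip y y - 2 < 0" using s by (simp add: algebra_simps)
    ultimately have "s * d\<^sup>2 \<le> 0"
      by (smt (verit) mult_pos_neg)
    then show ?thesis using s by (simp add: d_def mult_le_0_iff)
  qed
  then show ?thesis using x by blast
qed

text \<open>A Babuska-type theorem. \<open>S y\<close> represents \<open>x \<mapsto> b x y\<close>, that is, \<open>S\<close> is the adjoint of the
  operator of \<open>b\<close>; it is linear only up to vectors of norm zero, but \<open>c x y = ip (S x) (S y)\<close> is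
  still bilinear. The inf-sup condition bounds \<open>S\<close> from below, so \<open>c\<close> is equivalent to \<open>ip\<close> and
  hence complete. If \<open>z\<close> represents \<open>l\<close> with respect to \<open>c\<close>, then
  \<open>l y = ip (S z) (S y) = b (S z) y\<close>.\<close>
theorem inf_sup_solvable:
  assumes b: "bilinear_on V b"
    and bounded: "\<And>x y. \<lbrakk>x \<in> V; y \<in> V\<rbrakk> \<Longrightarrow> \<bar>b x y\<bar> \<le> K * nrm x * nrm y"
    and \<alpha>: "\<alpha> > 0"
    and inf_sup: "\<And>y. y \<in> V \<Longrightarrow> \<exists>x\<in>V. \<alpha> * (nrm y)\<^sup>2 \<le> b x y \<and> nrm x \<le> C * nrm y"
    and add: "\<And>x y. \<lbrakk>x \<in> V; y \<in> V\<rbrakk> \<Longrightarrow> l (x + y) = l x + l y"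
    and scale: "\<And>x r. x \<in> V \<Longrightarrow> l (r *\<^sub>R x) = r * l x"
    and l_bound: "\<And>x. x \<in> V \<Longrightarrow> \<bar>l x\<bar> \<le> L * nrm x"
  shows "\<exists>x\<in>V. \<forall>y\<in>V. b x y = l y"
proof -
  interpret b: bilinear_on V b by (rule b)
  have "\<exists>z\<in>V. \<forall>x\<in>V. ip z x = b x y" if "y \<in> V" for y
    using that bounded[of _ y]
    by (intro Riesz_representation[where C = "K * nrm y"]) (auto simp: b.bilin mult_ac)
  then obtain S where SV: "\<And>y. y \<in> V \<Longrightarrow> S y \<in> V"
    and S: "\<And>x y. \<lbrakk>x \<in> V; y \<in> V\<rbrakk> \<Longrightarrow> ip (S y) x = b x y"
    by metis
  define c where "c x y = ip (S x) (S y)" for x y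
  have c: "c x y = b (S y) x" if "x \<in> V" "y \<in> V" for x y
    using that SV by (simp add: c_def S)
  have c_sym: "c x y = c y x" if "x \<in> V" "y \<in> V" for x y
    using that SV by (simp add: c_def sym)
  have C0: "\<exists>C\<ge>0. \<forall>y\<in>V. nrm y \<le> C * sqrt (c y y)"
  proof (intro exI[of _ "\<bar>C\<bar> / \<alpha>"] conjI ballI)
    show "0 \<le> \<bar>C\<bar> / \<alpha>" using \<alpha> by simp
    fix y assume y: "y \<in> V"
    obtain x where x: "x \<in> V" "\<alpha> * (nrm y)\<^sup>2 \<le> b x y" "nrm x \<le> C * nrm y"
      using inf_sup[OF y] by blast
    have "\<alpha> * (nrm y)\<^sup>2 \<le> nrm (S y) * nrm x"
      using x(2) S[OF x(1) y] Cauchy_Schwarz[OF SV[OF y] x(1)] by simp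
    also have "\<dots> \<le> nrm (S y) * (\<bar>C\<bar> * nrm y)"
    proof (rule mult_left_mono)
      show "nrm x \<le> \<bar>C\<bar> * nrm y"
        using x(3) mult_right_mono[OF abs_ge_self nrm_nonneg[OF y], of C] by linarith
    qed (use SV y in simp)
    finally have "nrm y * (\<alpha> * nrm y) \<le> nrm y * (\<bar>C\<bar> * nrm (S y))"
      by (simp add: power2_eq_square mult_ac)
    then have "\<alpha> * nrm y \<le> \<bar>C\<bar> * nrm (S y)"
    proof (cases "nrm y = 0")
      case True
      then show ?thesis using SV y by simp
    next
      case False
      then have "nrm y > 0" using nrm_nonneg[OF y] by simp
      then show ?thesis
        using \<open>nrm y * (\<alpha> * nrm y) \<le> nrm y * (\<bar>C\<bar> * nrm (S y))\<close> by (rule mult_left_le_imp_le[rotated])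
    qed
    then show "nrm y \<le> \<bar>C\<bar> / \<alpha> * sqrt (c y y)"
      using \<alpha> by (simp add: c_def nrm_def field_simps)
  qed
  then obtain C' where C': "C' \<ge> 0" and lower: "\<And>y. y \<in> V \<Longrightarrow> nrm y \<le> C' * sqrt (c y y)" by blast
  have upper: "c x x \<le> (K * nrm x)\<^sup>2" if "x \<in> V" for x
  proof -
    have "c x x \<le> K * nrm (S x) * nrm x"
      using c[OF that that] bounded[OF SV[OF that] that] by simp
    then have le: "nrm (S x) * nrm (S x) \<le> nrm (S x) * (K * nrm x)"
      using nrm_sq[OF SV[OF that]] by (simp add: c_def power2_eq_square mult_ac)
    have "nrm (S x) \<le> \<bar>K * nrm x\<bar>"
    proof (cases "nrm (S x) = 0")
      case False
      then have "nrm (S x) > 0" using nrm_nonneg[OF SV[OF that]] by simp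
      then have "nrm (S x) \<le> K * nrm x" using le by (rule mult_left_le_imp_le[rotated])
      then show ?thesis by simp
    qed simp
    then have "(nrm (S x))\<^sup>2 \<le> \<bar>K * nrm x\<bar>\<^sup>2"
      using that SV by (intro power_mono) auto
    then show ?thesis using nrm_sq[OF SV[OF that]] by (simp add: c_def)
  qed
  interpret c: complete_semi_inner_product V c
  proof unfold_locales
    fix X :: "nat \<Rightarrow> 'v" assume X: "\<And>n. X n \<in> V"
      and cau: "\<And>e. e > 0 \<Longrightarrow> \<exists>N. \<forall>m\<ge>N. \<forall>n\<ge>N. c (X m - X n) (X m - X n) < (e::real)"
    have "\<exists>x\<in>V. (\<lambda>n. ip (X n - x) (X n - x)) \<longlonglongrightarrow> 0"
    proof (rule complete[OF X])
      fix e :: real assume e: "e > 0"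
      have "e / (C'\<^sup>2 + 1) > 0" using e by (simp add: add_nonneg_pos)
      then obtain N where N: "\<forall>m\<ge>N. \<forall>n\<ge>N. c (X m - X n) (X m - X n) < e / (C'\<^sup>2 + 1)"
        using cau by blast
      have "ip (X m - X n) (X m - X n) < e" if "m \<ge> N" "n \<ge> N" for m n
      proof -
        have V: "X m - X n \<in> V" using X by simp
        let ?c = "c (X m - X n) (X m - X n)"
        have c0: "0 \<le> ?c" using SV[OF V] by (simp add: c_def nonneg)
        have "(nrm (X m - X n))\<^sup>2 \<le> (C' * sqrt ?c)\<^sup>2"
          using lower[OF V] V by (intro power_mono) auto
        then have "ip (X m - X n) (X m - X n) \<le> C'\<^sup>2 * ?c"
          using c0 nrm_sq[OF V] by (simp add: power_mult_distrib)
        also have "\<dots> \<le> (C'\<^sup>2 + 1) * ?c"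
          using c0 by (intro mult_right_mono) auto
        also have "\<dots> < e"
        proof -
          have "0 < C'\<^sup>2 + 1" by (simp add: add_nonneg_pos)
          then show ?thesis using N that by (simp add: pos_less_divide_eq mult.commute)
        qed
        finally show ?thesis .
      qed
      then show "\<exists>N. \<forall>m\<ge>N. \<forall>n\<ge>N. ip (X m - X n) (X m - X n) < e" by blast
    qed
    then obtain x where x: "x \<in> V" and lim: "(\<lambda>n. ip (X n - x) (X n - x)) \<longlonglongrightarrow> 0" by blast
    have "(\<lambda>n. c (X n - x) (X n - x)) \<longlonglongrightarrow> 0"
    proof (rule tendsto_sandwich[OF _ _ tendsto_const])
      show "(\<lambda>n. K\<^sup>2 * ip (X n - x) (X n - x)) \<longlonglongrightarrow> 0"
        using tendsto_mult_left[OF lim, of "K\<^sup>2"] by simp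
      show "\<forall>\<^sub>F n in sequentially. 0 \<le> c (X n - x) (X n - x)"
        using SV X x by (intro always_eventually allI) (simp add: c_def nonneg)
      show "\<forall>\<^sub>F n in sequentially. c (X n - x) (X n - x) \<le> K\<^sup>2 * ip (X n - x) (X n - x)"
        using upper[of "X _ - x"] X x
        by (intro always_eventually allI) (simp add: power_mult_distrib nrm_sq)
    qed
    then show "\<exists>x\<in>V. (\<lambda>n. c (X n - x) (X n - x)) \<longlonglongrightarrow> 0" using x by blast
  next
    show c_left: "c (x + y) z = c x z + c y z" if "x \<in> V" "y \<in> V" "z \<in> V" for x y z
      using that SV by (simp add: c b.bilin)
    show c_scale: "c (r *\<^sub>R x) z = r * c x z" if "x \<in> V" "z \<in> V" for x z r
      using that SV by (simp add: c b.bilin)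
    show "c z (x + y) = c z x + c z y" if "x \<in> V" "y \<in> V" "z \<in> V" for x y z
      using that c_left[OF that] by (simp add: c_sym)
    show "c z (r *\<^sub>R x) = r * c z x" if "x \<in> V" "z \<in> V" for x z r
      using that c_scale[OF that] by (simp add: c_sym)
  qed (use SV in \<open>auto simp: subspace c_def sym nonneg\<close>)
  have "\<exists>z\<in>V. \<forall>y\<in>V. c z y = l y"
  proof (rule c.Riesz_representation[where C = "\<bar>L\<bar> * C'"])
    fix x assume x: "x \<in> V"
    have "\<bar>l x\<bar> \<le> \<bar>L\<bar> * nrm x"
      using l_bound[OF x] mult_right_mono[OF abs_ge_self nrm_nonneg[OF x], of L] by linarith
    also have "\<dots> \<le> \<bar>L\<bar> * (C' * sqrt (c x x))"
      using lower[OF x] by (intro mult_left_mono) auto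
    finally show "\<bar>l x\<bar> \<le> \<bar>L\<bar> * C' * c.nrm x"
      by (simp add: c.nrm_def)
  qed (use add scale in auto)
  then obtain z where z: "z \<in> V" "\<And>y. y \<in> V \<Longrightarrow> c z y = l y" by blast
  show ?thesis
  proof (intro bexI ballI)
    show "b (S z) y = l y" if "y \<in> V" for y
      using c[OF that z(1)] c_sym[OF that z(1)] z(2)[OF that] by simp
  qed (use SV z in simp)
qed

end


section \<open>A coupled pair of variational equations\<close>

lemma (in semi_inner_product) double_product_bound:
  assumes "x \<in> V" "y \<in> V"
  shows "2 * \<bar>ip x y\<bar> \<le> ip x x + ip y y"
proof -
  have "0 \<le> ip (x - y) (x - y)" "0 \<le> ip (x + y) (x + y)"
    using assms by (auto intro!: nonneg)
  then show ?thesis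
    using assms sym[of x y] by (simp add: bilin)
qed

lemma (in complete_semi_inner_product) product_complete:
  "complete_semi_inner_product (V \<times> V) (\<lambda>x y. ip (fst x) (fst y) + ip (snd x) (snd y))"
proof unfold_locales
  show "subspace (V \<times> V)" using subspace by (rule subspace_Times) (rule subspace)
  show "0 \<le> ip (fst x) (fst x) + ip (snd x) (snd x)" if "x \<in> V \<times> V" for x
    using that by (auto intro!: add_nonneg_nonneg nonneg)
  fix X :: "nat \<Rightarrow> 'v \<times> 'v"
  assume X: "\<And>n. X n \<in> V \<times> V"
    and cau: "\<And>e. e > 0 \<Longrightarrow> \<exists>N. \<forall>m\<ge>N. \<forall>n\<ge>N.
      ip (fst (X m - X n)) (fst (X m - X n)) + ip (snd (X m - X n)) (snd (X m - X n)) < e"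
  have V: "fst (X n) \<in> V" "snd (X n) \<in> V" for n
    using X[of n] by (auto simp: mem_Times_iff)
  have parts: "0 \<le> ip (fst (X m) - fst (X n)) (fst (X m) - fst (X n))"
    "0 \<le> ip (snd (X m) - snd (X n)) (snd (X m) - snd (X n))" for m n
    using V by (auto intro!: nonneg)
  have "\<exists>x\<in>V. (\<lambda>n. ip (fst (X n) - x) (fst (X n) - x)) \<longlonglongrightarrow> 0"
  proof (rule complete[OF V(1)])
    fix e :: real assume "e > 0"
    from cau[OF this] show "\<exists>N. \<forall>m\<ge>N. \<forall>n\<ge>N. ip (fst (X m) - fst (X n)) (fst (X m) - fst (X n)) < e"
      using parts(2) by (smt (verit) fst_diff snd_diff)
  qed
  moreover have "\<exists>x\<in>V. (\<lambda>n. ip (snd (X n) - x) (snd (X n) - x)) \<longlonglongrightarrow> 0"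
  proof (rule complete[OF V(2)])
    fix e :: real assume "e > 0"
    from cau[OF this] show "\<exists>N. \<forall>m\<ge>N. \<forall>n\<ge>N. ip (snd (X m) - snd (X n)) (snd (X m) - snd (X n)) < e"
      using parts(1) by (smt (verit) fst_diff snd_diff)
  qed
  ultimately obtain x y where "x \<in> V" "y \<in> V"
    "(\<lambda>n. ip (fst (X n) - x) (fst (X n) - x)) \<longlonglongrightarrow> 0" "(\<lambda>n. ip (snd (X n) - y) (snd (X n) - y)) \<longlonglongrightarrow> 0"
    by blast
  then show "\<exists>z\<in>V \<times> V. (\<lambda>n. ip (fst (X n - z)) (fst (X n - z)) + ip (snd (X n - z)) (snd (X n - z))) \<longlonglongrightarrow> 0"
    by (intro bexI[of _ "(x, y)"]) (auto intro: tendsto_add_zero)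
qed (auto simp: bilin sym algebra_simps)

text \<open>The linear system in abstract form: \<open>m\<close> is the \<open>L\<^sup>2\<close> inner product, \<open>d\<close> the Dirichlet form and
  \<open>r\<close> the form weighted by the coefficient \<open>H\<close>. The space is complete for \<open>m + d\<close>, the \<open>H\<^sup>1\<close> inner
  product.\<close>
locale coupled_forms =
  m: semi_inner_product V m + d: semi_inner_product V d + r: semi_inner_product V r +
  energy: complete_semi_inner_product V "\<lambda>x y. m x y + d x y"
  for V :: "'v::real_vector set" and m d r :: "'v \<Rightarrow> 'v \<Rightarrow> real" +
  fixes p q C :: real
  assumes p: "p > 0" and q: "q > 0" and C: "C \<ge> 0"
    and r_bound: "x \<in> V \<Longrightarrow> r x x \<le> C * m x x"
begin

definition solves :: "('v \<Rightarrow> real) \<Rightarrow> ('v \<Rightarrow> real) \<Rightarrow> 'v \<Rightarrow> 'v \<Rightarrow> bool" where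
  "solves l1 l2 w \<phi> \<longleftrightarrow> w \<in> V \<and> \<phi> \<in> V \<and>
    (\<forall>\<mu>\<in>V. m \<phi> \<mu> + p * d w \<mu> = l1 \<mu>) \<and>
    (\<forall>\<psi>\<in>V. - m w \<psi> + q * d \<phi> \<psi> + 1 / 2 * r \<phi> \<psi> = l2 \<psi>)"

text \<open>For the difference \<open>(z, \<xi>)\<close> of two solutions the diagonal test annihilates \<open>d z z\<close>, \<open>d \<xi> \<xi>\<close> and
  \<open>r \<xi> \<xi>\<close>, and by Cauchy-Schwarz every term with a factor \<open>d z\<close>, \<open>d \<xi>\<close> or \<open>r \<xi>\<close>. Crosswise
  testing then isolates \<open>m \<xi> \<xi>\<close> and \<open>m z z\<close>.\<close>
theorem unique:
  assumes 1: "solves l1 l2 w \<phi>" and 2: "solves l1 l2 w' \<phi>'"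
  shows "m (w' - w) (w' - w) = 0" "m (\<phi>' - \<phi>) (\<phi>' - \<phi>) = 0"
proof -
  define z \<xi> where "z = w' - w" and "\<xi> = \<phi>' - \<phi>"
  have V: "z \<in> V" "\<xi> \<in> V" using 1 2 by (auto simp: solves_def z_def \<xi>_def)
  have e1: "m \<xi> \<mu> + p * d z \<mu> = 0" if "\<mu> \<in> V" for \<mu>
  proof -
    have "m \<xi> \<mu> + p * d z \<mu> = (m \<phi>' \<mu> + p * d w' \<mu>) - (m \<phi> \<mu> + p * d w \<mu>)"
      using 1 2 that by (simp add: solves_def z_def \<xi>_def m.bilin d.bilin algebra_simps)
    then show ?thesis using 1 2 that by (simp add: solves_def)
  qed
  have e2: "- m z \<psi> + q * d \<xi> \<psi> + 1 / 2 * r \<xi> \<psi> = 0" if "\<psi> \<in> V" for \<psi>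
  proof -
    have "- m z \<psi> + q * d \<xi> \<psi> + 1 / 2 * r \<xi> \<psi> = (- m w' \<psi> + q * d \<phi>' \<psi> + 1 / 2 * r \<phi>' \<psi>)
        - (- m w \<psi> + q * d \<phi> \<psi> + 1 / 2 * r \<phi> \<psi>)"
      using 1 2 that by (simp add: solves_def z_def \<xi>_def m.bilin d.bilin r.bilin algebra_simps)
    then show ?thesis using 1 2 that by (simp add: solves_def)
  qed
  have "p * d z z + q * d \<xi> \<xi> + 1 / 2 * r \<xi> \<xi> = 0"
    using e1[OF V(1)] e2[OF V(2)] m.sym[OF V] by simp
  moreover have nn: "0 \<le> p * d z z" "0 \<le> q * d \<xi> \<xi>" "0 \<le> r \<xi> \<xi>"
    using p q V by (auto simp: d.nonneg r.nonneg)
  ultimately have "p * d z z = 0" "q * d \<xi> \<xi> = 0" "r \<xi> \<xi> = 0" by linarith+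
  then have "d z z = 0" "d \<xi> \<xi> = 0" "r \<xi> \<xi> = 0" using p q by auto
  then have "d z \<xi> = 0" "d \<xi> z = 0" "r \<xi> z = 0"
    using d.Cauchy_Schwarz[of z \<xi>] d.Cauchy_Schwarz[of \<xi> z] r.Cauchy_Schwarz[of \<xi> z] V
    by (auto simp: d.nrm_def r.nrm_def)
  then show "m (w' - w) (w' - w) = 0" "m (\<phi>' - \<phi>) (\<phi>' - \<phi>) = 0"
    using e1[OF V(2)] e2[OF V(1)] unfolding z_def[symmetric] \<xi>_def[symmetric] by auto
qed

definition form :: "'v \<times> 'v \<Rightarrow> 'v \<times> 'v \<Rightarrow> real" where
  "form x y = (m (snd x) (fst y) + p * d (fst x) (fst y)) +
    (- m (fst x) (snd y) + q * d (snd x) (snd y) + 1 / 2 * r (snd x) (snd y))"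

sublocale pair: complete_semi_inner_product "V \<times> V"
  "\<lambda>x y. (m (fst x) (fst y) + d (fst x) (fst y)) + (m (snd x) (snd y) + d (snd x) (snd y))"
  by (rule energy.product_complete)

lemma form_bilinear: "bilinear_on (V \<times> V) form"
  by unfold_locales (auto simp: form_def m.bilin d.bilin r.bilin algebra_simps intro: pair.subspace)

lemma component_bounds:
  assumes "x \<in> V \<times> V"
  shows "m.nrm (fst x) \<le> pair.nrm x" "m.nrm (snd x) \<le> pair.nrm x"
    "d.nrm (fst x) \<le> pair.nrm x" "d.nrm (snd x) \<le> pair.nrm x"
  using assms unfolding m.nrm_def d.nrm_def pair.nrm_def
  by (auto intro!: real_sqrt_le_mono simp: m.nonneg d.nonneg)

lemma form_bounded:
  assumes x: "x \<in> V \<times> V" and y: "y \<in> V \<times> V"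
  shows "\<bar>form x y\<bar> \<le> (2 + p + q + C) * pair.nrm x * pair.nrm y"
proof -
  have V: "fst x \<in> V" "snd x \<in> V" "fst y \<in> V" "snd y \<in> V" using x y by auto
  let ?n = "pair.nrm x * pair.nrm y"
  have m: "\<bar>m u v\<bar> \<le> ?n" if "u \<in> V" "v \<in> V" "m.nrm u \<le> pair.nrm x" "m.nrm v \<le> pair.nrm y" for u v
    using m.Cauchy_Schwarz[OF that(1,2)] mult_mono[OF that(3,4)] x that by simp
  have d: "\<bar>d u v\<bar> \<le> ?n" if "u \<in> V" "v \<in> V" "d.nrm u \<le> pair.nrm x" "d.nrm v \<le> pair.nrm y" for u v
    using d.Cauchy_Schwarz[OF that(1,2)] mult_mono[OF that(3,4)] x that by simp
  have rn: "r.nrm u \<le> sqrt C * m.nrm u" if "u \<in> V" for u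
    using r_bound[OF that] by (simp add: r.nrm_def m.nrm_def flip: real_sqrt_mult)
  have r: "\<bar>r (snd x) (snd y)\<bar> \<le> C * ?n"
  proof -
    have "\<bar>r (snd x) (snd y)\<bar> \<le> r.nrm (snd x) * r.nrm (snd y)"
      by (intro r.Cauchy_Schwarz V)
    also have "\<dots> \<le> (sqrt C * pair.nrm x) * (sqrt C * pair.nrm y)"
    proof (rule mult_mono)
      show "r.nrm (snd x) \<le> sqrt C * pair.nrm x"
        using rn[OF V(2)] mult_left_mono[OF component_bounds(2)[OF x], of "sqrt C"] C by simp
      show "r.nrm (snd y) \<le> sqrt C * pair.nrm y"
        using rn[OF V(4)] mult_left_mono[OF component_bounds(2)[OF y], of "sqrt C"] C by simp
    qed (use V C x in auto)
    also have "\<dots> = C * ?n" using C by simp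
    finally show ?thesis .
  qed
  have "\<bar>form x y\<bar> \<le> \<bar>m (snd x) (fst y)\<bar> + p * \<bar>d (fst x) (fst y)\<bar> + \<bar>m (fst x) (snd y)\<bar>
      + q * \<bar>d (snd x) (snd y)\<bar> + 1 / 2 * \<bar>r (snd x) (snd y)\<bar>"
  proof -
    have "\<bar>p * d (fst x) (fst y)\<bar> = p * \<bar>d (fst x) (fst y)\<bar>" "\<bar>q * d (snd x) (snd y)\<bar> = q * \<bar>d (snd x) (snd y)\<bar>"
      using p q by (auto simp: abs_mult)
    then show ?thesis unfolding form_def by linarith
  qed
  also have "\<dots> \<le> ?n + p * ?n + ?n + q * ?n + C * ?n"
  proof -
    have "\<bar>r (snd x) (snd y)\<bar> / 2 \<le> C * ?n" using r by linarith
    moreover have "p * \<bar>d (fst x) (fst y)\<bar> \<le> p * ?n" "q * \<bar>d (snd x) (snd y)\<bar> \<le> q * ?n"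
      using p q V component_bounds[OF x] component_bounds[OF y] by (auto intro!: mult_left_mono d)
    moreover have "\<bar>m (snd x) (fst y)\<bar> \<le> ?n" "\<bar>m (fst x) (snd y)\<bar> \<le> ?n"
      using V component_bounds[OF x] component_bounds[OF y] by (auto intro!: m)
    ultimately show ?thesis by linarith
  qed
  also have "\<dots> = (2 + p + q + C) * pair.nrm x * pair.nrm y"
    by (simp add: algebra_simps)
  finally show ?thesis .
qed

text \<open>The rotation \<open>(\<mu>, \<psi>) \<mapsto> (\<mu> - t \<psi>, \<psi> + t \<mu>)\<close> turns the antisymmetric coupling into
  \<open>t (m \<mu> \<mu> + m \<psi> \<psi>)\<close>. It multiplies norms by exactly \<open>sqrt (1 + t\<^sup>2)\<close>, and it creates the cross
  terms \<open>t (q - p) d \<mu> \<psi>\<close>, absorbed by the gradients once \<open>t (p + q) \<le> min p q\<close>, and \<open>t / 2 r \<mu> \<psi>\<close>,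
  absorbed by completing the square in \<open>r\<close> once \<open>t C \<le> 4\<close>.\<close>
lemma form_inf_sup:
  "\<exists>c K. c > 0 \<and> (\<forall>y\<in>V \<times> V. \<exists>x\<in>V \<times> V. c * (pair.nrm y)\<^sup>2 \<le> form x y \<and> pair.nrm x \<le> K * pair.nrm y)"
proof -
  define t where "t = min (min p q / (p + q)) (4 / (C + 1))"
  have t: "t > 0" using p q C by (simp add: t_def)
  have tpq: "t * (p + q) \<le> p" "t * (p + q) \<le> q"
  proof -
    have "t * (p + q) \<le> min p q / (p + q) * (p + q)"
      using p q by (intro mult_right_mono) (auto simp: t_def)
    then show "t * (p + q) \<le> p" "t * (p + q) \<le> q" using p q by auto
  qed
  have tC: "t * C \<le> 4"
  proof -
    have "t * C \<le> 4 / (C + 1) * C" using C by (intro mult_right_mono) (auto simp: t_def)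
    also have "\<dots> \<le> 4" using C by (simp add: field_simps)
    finally show ?thesis .
  qed
  define c where "c = min (t / 2) (min p q / 2)"
  have c: "c > 0" "c \<le> t / 2" "c \<le> p / 2" "c \<le> q / 2" using t p q by (auto simp: c_def)
  have "\<exists>x\<in>V \<times> V. c * (pair.nrm y)\<^sup>2 \<le> form x y \<and> pair.nrm x \<le> sqrt (1 + t\<^sup>2) * pair.nrm y"
    if y: "y \<in> V \<times> V" for y
  proof
    obtain \<mu> \<psi> where y_eq: "y = (\<mu>, \<psi>)" and V: "\<mu> \<in> V" "\<psi> \<in> V" using y by auto
    define x where "x = (fst y - t *\<^sub>R snd y, snd y + t *\<^sub>R fst y)"
    show xV: "(fst y - t *\<^sub>R snd y, snd y + t *\<^sub>R fst y) \<in> V \<times> V" using V by (simp add: y_eq)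
    note bil = m.bilin d.bilin r.bilin
    have "form x y = t * (m \<mu> \<mu> + m \<psi> \<psi>) + p * d \<mu> \<mu> + q * d \<psi> \<psi> + 1 / 2 * r \<psi> \<psi>
        + t * (q - p) * d \<mu> \<psi> + t / 2 * r \<mu> \<psi>"
      using V m.sym[OF V] d.sym[OF V] r.sym[OF V]
      by (simp add: form_def x_def y_eq bil algebra_simps)
    moreover have "1 / 2 * r \<psi> \<psi> + t / 2 * r \<mu> \<psi> \<ge> - (t / 2 * m \<mu> \<mu>)"
    proof -
      have "0 \<le> r (\<psi> + (t / 2) *\<^sub>R \<mu>) (\<psi> + (t / 2) *\<^sub>R \<mu>)" using V by (intro r.nonneg) simp
      also have "\<dots> = r \<psi> \<psi> + t * r \<mu> \<psi> + t / 4 * (t * r \<mu> \<mu>)"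
        using V r.sym[OF V] by (simp add: r.bilin algebra_simps)
      also have "t / 4 * (t * r \<mu> \<mu>) \<le> t / 4 * (4 * m \<mu> \<mu>)"
      proof (rule mult_left_mono)
        have "t * r \<mu> \<mu> \<le> t * (C * m \<mu> \<mu>)"
          using t by (intro mult_left_mono r_bound V) simp
        also have "\<dots> \<le> 4 * m \<mu> \<mu>"
          using mult_right_mono[OF tC m.nonneg[OF V(1)]] by (simp add: mult.assoc)
        finally show "t * r \<mu> \<mu> \<le> 4 * m \<mu> \<mu>" .
      qed (use t in simp)
      finally show ?thesis by simp
    qed
    moreover have "t * (q - p) * d \<mu> \<psi> \<ge> - (p / 2 * d \<mu> \<mu>) - q / 2 * d \<psi> \<psi>"
    proof -
      have "\<bar>t * (q - p) * d \<mu> \<psi>\<bar> \<le> t * (p + q) * \<bar>d \<mu> \<psi>\<bar>"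
        unfolding abs_mult using t p q by (intro mult_right_mono) auto
      also have "\<dots> \<le> t * (p + q) * ((d \<mu> \<mu> + d \<psi> \<psi>) / 2)"
        using d.double_product_bound[OF V] t p q by (intro mult_left_mono) auto
      also have "\<dots> \<le> p / 2 * d \<mu> \<mu> + q / 2 * d \<psi> \<psi>"
        using mult_right_mono[OF tpq(1) d.nonneg[OF V(1)]] mult_right_mono[OF tpq(2) d.nonneg[OF V(2)]]
        by (simp add: algebra_simps)
      finally show ?thesis by linarith
    qed
    moreover have "c * (pair.nrm y)\<^sup>2 \<le> t / 2 * m \<mu> \<mu> + t / 2 * m \<psi> \<psi> + p / 2 * d \<mu> \<mu> + q / 2 * d \<psi> \<psi>"
    proof -
      have "(pair.nrm y)\<^sup>2 = m \<mu> \<mu> + d \<mu> \<mu> + (m \<psi> \<psi> + d \<psi> \<psi>)"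
        using pair.nrm_sq[OF y] by (simp add: y_eq)
      then show ?thesis
        using mult_right_mono[OF c(2) m.nonneg[OF V(1)]] mult_right_mono[OF c(2) m.nonneg[OF V(2)]]
          mult_right_mono[OF c(3) d.nonneg[OF V(1)]] mult_right_mono[OF c(4) d.nonneg[OF V(2)]]
        by (simp add: algebra_simps)
    qed
    moreover have "0 \<le> t * m \<psi> \<psi>" using t V by (simp add: m.nonneg)
    ultimately have 1: "c * (pair.nrm y)\<^sup>2 \<le> form x y"
      by (simp add: algebra_simps)
    have "pair.nrm x = sqrt (1 + t\<^sup>2) * pair.nrm y"
      unfolding pair.nrm_def real_sqrt_mult[symmetric]
      using V m.sym[OF V] d.sym[OF V]
      by (simp add: x_def y_eq bil algebra_simps power2_eq_square)
    with 1 show "c * (pair.nrm y)\<^sup>2 \<le> form (fst y - t *\<^sub>R snd y, snd y + t *\<^sub>R fst y) y \<and>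
        pair.nrm (fst y - t *\<^sub>R snd y, snd y + t *\<^sub>R fst y) \<le> sqrt (1 + t\<^sup>2) * pair.nrm y"
      by (simp add: x_def)
  qed
  then show ?thesis using c(1) by blast
qed

theorem exists_solution:
  assumes l1: "\<And>x y. \<lbrakk>x \<in> V; y \<in> V\<rbrakk> \<Longrightarrow> l1 (x + y) = l1 x + l1 y" "\<And>x c. x \<in> V \<Longrightarrow> l1 (c *\<^sub>R x) = c * l1 x"
      "\<And>x. x \<in> V \<Longrightarrow> \<bar>l1 x\<bar> \<le> \<beta> * m.nrm x"
    and l2: "\<And>x y. \<lbrakk>x \<in> V; y \<in> V\<rbrakk> \<Longrightarrow> l2 (x + y) = l2 x + l2 y" "\<And>x c. x \<in> V \<Longrightarrow> l2 (c *\<^sub>R x) = c * l2 x"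
      "\<And>x. x \<in> V \<Longrightarrow> \<bar>l2 x\<bar> \<le> \<gamma> * m.nrm x"
  shows "\<exists>w \<phi>. solves l1 l2 w \<phi>"
proof -
  obtain c K where c: "c > 0"
    and infsup: "\<And>y. y \<in> V \<times> V \<Longrightarrow> \<exists>x\<in>V \<times> V. c * (pair.nrm y)\<^sup>2 \<le> form x y \<and> pair.nrm x \<le> K * pair.nrm y"
    using form_inf_sup by blast
  have "\<exists>x\<in>V \<times> V. \<forall>y\<in>V \<times> V. form x y = l1 (fst y) + l2 (snd y)"
  proof (rule pair.inf_sup_solvable[OF form_bilinear form_bounded c infsup])
    fix y assume y: "y \<in> V \<times> V"
    then have V: "fst y \<in> V" "snd y \<in> V" by auto
    have "\<bar>l1 (fst y)\<bar> \<le> \<bar>\<beta>\<bar> * pair.nrm y"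
    proof -
      have "\<bar>l1 (fst y)\<bar> \<le> \<bar>\<beta>\<bar> * m.nrm (fst y)"
        using l1(3)[OF V(1)] mult_right_mono[OF abs_ge_self m.nrm_nonneg[OF V(1)], of \<beta>] by linarith
      also have "\<dots> \<le> \<bar>\<beta>\<bar> * pair.nrm y"
        using component_bounds[OF y] by (intro mult_left_mono) auto
      finally show ?thesis .
    qed
    moreover have "\<bar>l2 (snd y)\<bar> \<le> \<bar>\<gamma>\<bar> * pair.nrm y"
    proof -
      have "\<bar>l2 (snd y)\<bar> \<le> \<bar>\<gamma>\<bar> * m.nrm (snd y)"
        using l2(3)[OF V(2)] mult_right_mono[OF abs_ge_self m.nrm_nonneg[OF V(2)], of \<gamma>] by linarith
      also have "\<dots> \<le> \<bar>\<gamma>\<bar> * pair.nrm y"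
        using component_bounds[OF y] by (intro mult_left_mono) auto
      finally show ?thesis .
    qed
    ultimately show "\<bar>l1 (fst y) + l2 (snd y)\<bar> \<le> (\<bar>\<beta>\<bar> + \<bar>\<gamma>\<bar>) * pair.nrm y"
      by (simp add: algebra_simps)
  qed (use l1 l2 in \<open>auto simp: algebra_simps\<close>)
  then obtain w \<phi> where V: "w \<in> V" "\<phi> \<in> V"
    and eq: "\<And>y. y \<in> V \<times> V \<Longrightarrow> form (w, \<phi>) y = l1 (fst y) + l2 (snd y)" by auto
  have zero: "m x 0 = 0" "d x 0 = 0" "r x 0 = 0" "l1 0 = 0" "l2 0 = 0" if "x \<in> V" for x
    using m.scale_right[OF m.subspace_closed(1) that, of 0] d.scale_right[OF m.subspace_closed(1) that, of 0]
      r.scale_right[OF m.subspace_closed(1) that, of 0] l1(2)[OF m.subspace_closed(1), of 0] l2(2)[OF m.subspace_closed(1), of 0] by auto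
  have "m \<phi> \<mu> + p * d w \<mu> = l1 \<mu>" if "\<mu> \<in> V" for \<mu>
    using eq[of "(\<mu>, 0)"] that V zero[OF V(1)] zero[OF V(2)] by (simp add: form_def)
  moreover have "- m w \<psi> + q * d \<phi> \<psi> + 1 / 2 * r \<phi> \<psi> = l2 \<psi>" if "\<psi> \<in> V" for \<psi>
    using eq[of "(0, \<psi>)"] that V zero[OF V(1)] zero[OF V(2)] by (simp add: form_def)
  ultimately show ?thesis using V by (auto simp: solves_def)
qed

end


section \<open>Square-integrable functions\<close>

lemma L2_measurable: "u \<in> L2 S \<Longrightarrow> u \<in> borel_measurable (lebesgue_on S)"
  by (simp add: L2_def)

lemma L2_integrable_norm_sq: "u \<in> L2 S \<Longrightarrow> integrable (lebesgue_on S) (\<lambda>x. (norm (u x))\<^sup>2)"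
  by (simp add: L2_def)

lemma L2_bound:
  assumes "v \<in> L2 S" "u \<in> borel_measurable (lebesgue_on S)"
    "AE x in lebesgue_on S. norm (u x) \<le> C * norm (v x)"
  shows "u \<in> L2 S"
proof -
  have "integrable (lebesgue_on S) (\<lambda>x. (norm (u x))\<^sup>2)"
  proof (rule Bochner_Integration.integrable_bound)
    show "integrable (lebesgue_on S) (\<lambda>x. C\<^sup>2 * (norm (v x))\<^sup>2)"
      using L2_integrable_norm_sq[OF assms(1)] by simp
    show "(\<lambda>x. (norm (u x))\<^sup>2) \<in> borel_measurable (lebesgue_on S)"
      using assms(2) by measurable
    show "AE x in lebesgue_on S. norm ((norm (u x))\<^sup>2) \<le> norm (C\<^sup>2 * (norm (v x))\<^sup>2)"
      using assms(3) by eventually_elim (auto simp flip: power_mult_distrib intro!: power_mono)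
  qed
  then show ?thesis using assms(2) by (simp add: L2_def)
qed

lemma subspace_L2: "subspace (L2 S :: (real^'d \<Rightarrow> 'b::euclidean_space) set)"
proof (rule subspaceI)
  show "0 \<in> L2 S" by (simp add: L2_def zero_fun_def)
  fix u v :: "real^'d \<Rightarrow> 'b" and c :: real
  assume u: "u \<in> L2 S"
  note [measurable] = L2_measurable[OF u]
  show "c *\<^sub>R u \<in> L2 S"
    using u by (rule L2_bound[where C = "\<bar>c\<bar>"]) (auto simp: scaleR_fun_def)
  assume v: "v \<in> L2 S"
  note [measurable] = L2_measurable[OF v]
  have "integrable (lebesgue_on S) (\<lambda>x. (norm ((u + v) x))\<^sup>2)"
  proof (rule Bochner_Integration.integrable_bound)
    show "integrable (lebesgue_on S) (\<lambda>x. 2 * (norm (u x))\<^sup>2 + 2 * (norm (v x))\<^sup>2)"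
      using L2_integrable_norm_sq[OF u] L2_integrable_norm_sq[OF v] by simp
    show "(\<lambda>x. (norm ((u + v) x))\<^sup>2) \<in> borel_measurable (lebesgue_on S)"
      by (simp add: plus_fun_def)
    show "AE x in lebesgue_on S. norm ((norm ((u + v) x))\<^sup>2) \<le> norm (2 * (norm (u x))\<^sup>2 + 2 * (norm (v x))\<^sup>2)"
    proof (rule AE_I2)
      fix x
      have "(norm (u x + v x))\<^sup>2 \<le> (norm (u x) + norm (v x))\<^sup>2"
        by (intro power_mono norm_triangle_ineq) simp
      also have "\<dots> \<le> 2 * (norm (u x))\<^sup>2 + 2 * (norm (v x))\<^sup>2"
        using sum_squares_ge_zero[of "norm (u x) - norm (v x)" 0]
        by (simp add: power2_eq_square algebra_simps)
      finally show "norm ((norm ((u + v) x))\<^sup>2) \<le> norm (2 * (norm (u x))\<^sup>2 + 2 * (norm (v x))\<^sup>2)"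
        by simp
    qed
  qed
  then show "u + v \<in> L2 S" by (simp add: L2_def plus_fun_def)
qed

lemma L2_inner_integrable:
  assumes u: "u \<in> L2 S" and v: "v \<in> L2 S"
  shows "integrable (lebesgue_on S) (\<lambda>x. u x \<bullet> v x)"
proof (rule Bochner_Integration.integrable_bound)
  note [measurable] = L2_measurable[OF u] L2_measurable[OF v]
  show "integrable (lebesgue_on S) (\<lambda>x. (norm (u x))\<^sup>2 + (norm (v x))\<^sup>2)"
    using L2_integrable_norm_sq[OF u] L2_integrable_norm_sq[OF v] by simp
  show "(\<lambda>x. u x \<bullet> v x) \<in> borel_measurable (lebesgue_on S)" by measurable
  show "AE x in lebesgue_on S. norm (u x \<bullet> v x) \<le> norm ((norm (u x))\<^sup>2 + (norm (v x))\<^sup>2)"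
  proof (rule AE_I2)
    fix x
    have "\<bar>u x \<bullet> v x\<bar> \<le> norm (u x) * norm (v x)" by (rule Cauchy_Schwarz_ineq2)
    also have "\<dots> \<le> (norm (u x))\<^sup>2 + (norm (v x))\<^sup>2"
      using sum_squares_bound[of "norm (u x)" "norm (v x)"]
        mult_nonneg_nonneg[OF norm_ge_zero[of "u x"] norm_ge_zero[of "v x"]] by linarith
    finally show "norm (u x \<bullet> v x) \<le> norm ((norm (u x))\<^sup>2 + (norm (v x))\<^sup>2)" by simp
  qed
qed

lemma L2_inner_self: "L2_inner S u u = (\<integral>x. (norm (u x))\<^sup>2 \<partial>(lebesgue_on S))"
  by (simp add: L2_inner_def power2_norm_eq_inner)

lemma semi_inner_product_L2: "semi_inner_product (L2 S) (L2_inner S)"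
proof unfold_locales
  show "subspace (L2 S)" by (rule subspace_L2)
qed (auto simp: L2_inner_def inner_add_left inner_add_right inner_commute L2_inner_integrable
      intro: integral_nonneg_AE)

text \<open>Riesz-Fischer. Along a subsequence with \<open>\<integral> D\<^sub>k\<^sup>2 \<le> 4\<^sup>-\<^sup>k\<close> for the increments \<open>D\<^sub>k\<close>, the
  weighted series \<open>\<Sum> 2\<^sup>k D\<^sub>k\<^sup>2\<close> is integrable, hence finite almost everywhere. There
  \<open>D\<^sub>k \<le> 2\<^sup>-\<^sup>k\<^sup>/\<^sup>2\<close> eventually, so the increments are summable. The weights make this work without
  finiteness of the measure. Fatou's lemma identifies the pointwise limit as the \<open>L\<^sup>2\<close> limit.\<close>
lemma L2_Cauchy_limit:
  fixes X :: "nat \<Rightarrow> real^'d \<Rightarrow> 'b::euclidean_space"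
  assumes X: "\<And>n. X n \<in> L2 S"
    and Cauchy: "\<And>e. e > 0 \<Longrightarrow> \<exists>N. \<forall>m\<ge>N. \<forall>n\<ge>N. L2_inner S (X m - X n) (X m - X n) < e"
  shows "\<exists>u\<in>L2 S. (\<lambda>n. L2_inner S (X n - u) (X n - u)) \<longlonglongrightarrow> 0"
proof -
  let ?M = "lebesgue_on S"
  note [measurable] = L2_measurable[OF X]
  interpret semi_inner_product "L2 S" "L2_inner S" by (rule semi_inner_product_L2)
  have nn: "(\<integral>\<^sup>+x. ennreal ((norm (X m x - X n x))\<^sup>2) \<partial>?M) = ennreal (L2_inner S (X m - X n) (X m - X n))" for m n
    using L2_integrable_norm_sq[OF subspace_closed(3)[OF X X], of m n]
    by (simp add: L2_inner_self nn_integral_eq_integral)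
  have "\<forall>k::nat. \<exists>N. \<forall>m\<ge>N. \<forall>n\<ge>N. L2_inner S (X m - X n) (X m - X n) < (1 / 4) ^ k"
    using Cauchy by simp
  then obtain N where N: "\<And>k m n. \<lbrakk>m \<ge> N k; n \<ge> N k\<rbrakk> \<Longrightarrow> L2_inner S (X m - X n) (X m - X n) < (1 / 4) ^ k"
    by metis
  \<comment> \<open>The sum makes \<open>r\<close> monotone and at least \<open>N k\<close>; the summand \<open>k\<close> sends it to infinity.\<close>
  define r where "r k = k + (\<Sum>j\<le>k. N j)" for k :: nat
  have r_N: "N k \<le> r k" for k
    unfolding r_def using member_le_sum[of k "{..k}" N] by simp
  have r_mono: "r k \<le> r (Suc k)" and r_id: "k \<le> r k" for k
    by (auto simp: r_def)
  define D where "D k x = norm (X (r (Suc k)) x - X (r k) x)" for k x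
  have D[measurable]: "D k \<in> borel_measurable ?M" for k
    by (simp add: D_def[abs_def])
  have D_int: "(\<integral>\<^sup>+x. ennreal (2 ^ k * (D k x)\<^sup>2) \<partial>?M) \<le> ennreal ((1 / 2) ^ k)" for k
  proof -
    have "(\<integral>\<^sup>+x. ennreal (2 ^ k * (D k x)\<^sup>2) \<partial>?M) = ennreal (2 ^ k) * (\<integral>\<^sup>+x. ennreal ((D k x)\<^sup>2) \<partial>?M)"
      by (simp add: ennreal_mult nn_integral_cmult)
    also have "\<dots> \<le> ennreal (2 ^ k) * ennreal ((1 / 4) ^ k)"
      unfolding D_def nn using N[of k "r (Suc k)" "r k"] r_N[of k] r_mono[of k]
      by (intro mult_left_mono ennreal_leI) auto
    also have "\<dots> = ennreal ((1 / 2) ^ k)"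
      by (simp flip: ennreal_mult power_mult_distrib)
    finally show ?thesis .
  qed
  have "(\<integral>\<^sup>+x. (\<Sum>k. ennreal (2 ^ k * (D k x)\<^sup>2)) \<partial>?M) \<le> (\<Sum>k. ennreal ((1 / 2) ^ k))"
    by (subst nn_integral_suminf) (auto intro!: suminf_le D_int)
  also have "\<dots> < \<infinity>"
    by (subst suminf_ennreal2) (auto intro!: summable_geometric)
  finally have "(\<integral>\<^sup>+x. (\<Sum>k. ennreal (2 ^ k * (D k x)\<^sup>2)) \<partial>?M) \<noteq> \<infinity>"
    by simp
  then have "AE x in ?M. (\<Sum>k. ennreal (2 ^ k * (D k x)\<^sup>2)) \<noteq> \<infinity>"
    by (intro nn_integral_noteq_infinite) auto
  then have conv: "AE x in ?M. convergent (\<lambda>k. X (r k) x)"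
  proof eventually_elim
    case (elim x)
    have "summable (\<lambda>k. 2 ^ k * (D k x)\<^sup>2)"
      using elim by (intro summable_suminf_not_top) auto
    then have "(\<lambda>k. 2 ^ k * (D k x)\<^sup>2) \<longlonglongrightarrow> 0" by (rule summable_LIMSEQ_zero)
    then have "\<forall>\<^sub>F k in sequentially. 2 ^ k * (D k x)\<^sup>2 < 1"
      by (rule order_tendstoD) simp
    then have "\<forall>\<^sub>F k in sequentially. norm (X (r (Suc k)) x - X (r k) x) \<le> (1 / sqrt 2) ^ k"
    proof eventually_elim
      case (elim k)
      then have "(D k x)\<^sup>2 \<le> ((1 / sqrt 2) ^ k)\<^sup>2"
        by (simp add: power_divide real_sqrt_power[symmetric] field_simps)
      then have "D k x \<le> (1 / sqrt 2) ^ k" by (rule power2_le_imp_le) simp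
      then show ?case by (simp add: D_def)
    qed
    moreover have "summable (\<lambda>k. (1 / sqrt 2) ^ k)"
      by (intro summable_geometric) simp
    ultimately have "summable (\<lambda>k. X (r (Suc k)) x - X (r k) x)"
      by (rule summable_comparison_test_ev)
    then have "convergent (\<lambda>n. \<Sum>k<n. X (r (Suc k)) x - X (r k) x)"
      by (simp add: summable_iff_convergent)
    then have "convergent (\<lambda>n. X (r n) x - X (r 0) x)"
      by (simp only: sum_lessThan_telescope[of "\<lambda>k. X (r k) x"])
    then show ?case
      using convergent_add[OF _ convergent_const[of "X (r 0) x"]] by fastforce
  qed
  define u where "u x = lim (\<lambda>k. X (r k) x)" for x
  have um[measurable]: "u \<in> borel_measurable ?M"
    unfolding u_def by (rule borel_measurable_lim_metric) simp
  have lim: "AE x in ?M. (\<lambda>k. X (r k) x) \<longlonglongrightarrow> u x"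
    using conv by eventually_elim (simp add: u_def convergent_LIMSEQ_iff)
  have Fatou: "\<exists>N. \<forall>m\<ge>N. (\<integral>\<^sup>+x. ennreal ((norm (X m x - u x))\<^sup>2) \<partial>?M) \<le> ennreal e" if "e > 0" for e
  proof -
    obtain N where N: "\<And>m n. \<lbrakk>m \<ge> N; n \<ge> N\<rbrakk> \<Longrightarrow> L2_inner S (X m - X n) (X m - X n) < e"
      using Cauchy[OF \<open>e > 0\<close>] by blast
    have "(\<integral>\<^sup>+x. ennreal ((norm (X m x - u x))\<^sup>2) \<partial>?M) \<le> ennreal e" if "m \<ge> N" for m
    proof -
      have "(\<integral>\<^sup>+x. ennreal ((norm (X m x - u x))\<^sup>2) \<partial>?M)
          = (\<integral>\<^sup>+x. liminf (\<lambda>k. ennreal ((norm (X m x - X (r k) x))\<^sup>2)) \<partial>?M)"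
      proof (rule nn_integral_cong_AE)
        show "AE x in ?M. ennreal ((norm (X m x - u x))\<^sup>2) = liminf (\<lambda>k. ennreal ((norm (X m x - X (r k) x))\<^sup>2))"
          using lim
        proof eventually_elim
          case (elim x)
          have "(\<lambda>k. ennreal ((norm (X m x - X (r k) x))\<^sup>2)) \<longlonglongrightarrow> ennreal ((norm (X m x - u x))\<^sup>2)"
            by (intro tendsto_intros elim)
          from lim_imp_Liminf[OF _ this] show ?case by simp
        qed
      qed
      also have "\<dots> \<le> liminf (\<lambda>k. \<integral>\<^sup>+x. ennreal ((norm (X m x - X (r k) x))\<^sup>2) \<partial>?M)"
        by (rule nn_integral_liminf) simp
      also have "\<dots> \<le> liminf (\<lambda>k. ennreal e)"
      proof (rule Liminf_mono)
        show "\<forall>\<^sub>F k in sequentially. (\<integral>\<^sup>+x. ennreal ((norm (X m x - X (r k) x))\<^sup>2) \<partial>?M) \<le> ennreal e"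
          using eventually_ge_at_top[of N]
        proof eventually_elim
          case (elim k)
          then show ?case
            unfolding nn using N[OF that, of "r k"] r_id[of k] by (intro ennreal_leI) simp
        qed
      qed
      finally show ?thesis by (simp add: Liminf_const)
    qed
    then show ?thesis by blast
  qed
  have diff: "X m - u \<in> L2 S" if "(\<integral>\<^sup>+x. ennreal ((norm (X m x - u x))\<^sup>2) \<partial>?M) \<le> ennreal e" for m e
  proof -
    have "(\<integral>\<^sup>+x. ennreal ((norm (X m x - u x))\<^sup>2) \<partial>?M) < \<infinity>"
      using that by (simp add: order_le_less_trans)
    then show ?thesis
      by (auto simp: L2_def fun_diff_def intro!: integrableI_nonneg)
  qed
  obtain m where "X m - u \<in> L2 S"
    using Fatou[of 1] diff by (meson order.refl zero_less_one)
  from subspace_closed(3)[OF X[of m] this] have u: "u \<in> L2 S" by simp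
  have "(\<lambda>n. L2_inner S (X n - u) (X n - u)) \<longlonglongrightarrow> 0"
  proof (rule LIMSEQ_I)
    fix e :: real assume e: "e > 0"
    obtain N where N: "\<And>m. m \<ge> N \<Longrightarrow> (\<integral>\<^sup>+x. ennreal ((norm (X m x - u x))\<^sup>2) \<partial>?M) \<le> ennreal (e / 2)"
      using Fatou[of "e / 2"] e by auto
    have "norm (L2_inner S (X n - u) (X n - u) - 0) < e" if "n \<ge> N" for n
    proof -
      have d: "X n - u \<in> L2 S" using X u by simp
      have "ennreal (L2_inner S (X n - u) (X n - u)) \<le> ennreal (e / 2)"
        using N[OF that] nn_integral_eq_integral[OF L2_integrable_norm_sq[OF d]]
        by (simp add: L2_inner_self)
      then show ?thesis
        using e nonneg[OF d] by (simp add: ennreal_le_iff)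
    qed
    then show "\<exists>N. \<forall>n\<ge>N. norm (L2_inner S (X n - u) (X n - u) - 0) < e" by blast
  qed
  then show ?thesis using u by blast
qed

interpretation L2: complete_semi_inner_product "L2 S" "L2_inner S" for S :: "(real^'d) set"
proof (intro complete_semi_inner_product.intro semi_inner_product_L2 complete_semi_inner_product_axioms.intro)
qed (rule L2_Cauchy_limit)


section \<open>Smooth bumps on boxes\<close>

text \<open>The smooth function \<open>exp (- k / s)\<close> for \<open>s > 0\<close>, extended by zero, divided by a power of \<open>s\<close>.
  Including the powers makes the family closed under differentiation up to linear combinations.
  The parameter \<open>k\<close> tends to zero later: that is how the bumps approach an indicator.\<close>
definition exp_recip :: "real \<Rightarrow> nat \<Rightarrow> real \<Rightarrow> real" where
  "exp_recip k m s = (if s > 0 then exp (- k / s) / s ^ m else 0)"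

lemma exp_recip_tendsto_0:
  assumes "k > 0"
  shows "(exp_recip k m \<longlongrightarrow> 0) (at 0)"
proof -
  have inv: "filterlim (\<lambda>s. k / s) at_top (at_right 0)"
    using assms by real_asymp
  have "((\<lambda>s. (k / s) ^ m / exp (k / s)) \<longlongrightarrow> 0) (at_right 0)"
    by (rule filterlim_compose[OF tendsto_power_div_exp_0 inv])
  then have "((\<lambda>s. (1 / k ^ m) * ((k / s) ^ m / exp (k / s))) \<longlongrightarrow> (1 / k ^ m) * 0) (at_right 0)"
    by (intro tendsto_mult_left)
  moreover have "\<forall>\<^sub>F s in at_right 0. (1 / k ^ m) * ((k / s) ^ m / exp (k / s)) = exp_recip k m s"
    using eventually_at_right_less[of 0]
    by eventually_elim (use assms in \<open>simp add: exp_recip_def power_divide exp_minus field_simps\<close>)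
  ultimately have r: "(exp_recip k m \<longlongrightarrow> 0) (at_right 0)"
    by (simp add: tendsto_cong)
  have l: "(exp_recip k m \<longlongrightarrow> 0) (at_left 0)"
  proof (rule tendsto_eventually)
    show "\<forall>\<^sub>F s in at_left 0. exp_recip k m s = 0"
      unfolding exp_recip_def eventually_at_filter by (simp add: always_eventually)
  qed
  show ?thesis using l r by (simp add: filterlim_at_split)
qed

lemma exp_recip_has_derivative:
  assumes "k > 0"
  shows "(exp_recip k m has_real_derivative
            k * exp_recip k (m + 2) s - m * exp_recip k (m + 1) s) (at s)"
proof (cases s "0 :: real" rule: linorder_cases)
  case less
  have "((\<lambda>_. 0) has_real_derivative 0) (at s)" by simp
  then have "(exp_recip k m has_real_derivative 0) (at s)"
    by (rule DERIV_cong_ev[THEN iffD1, rotated -1])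
       (use less in \<open>auto simp: exp_recip_def eventually_nhds intro!: exI[of _ "{..<0}"]\<close>)
  then show ?thesis using less by (simp add: exp_recip_def)
next
  case equal
  have "((\<lambda>h. (exp_recip k m (0 + h) - exp_recip k m 0) / h) \<longlongrightarrow> 0) (at 0)"
  proof (rule Lim_transform_eventually[OF exp_recip_tendsto_0[OF assms, of "Suc m"]])
    show "\<forall>\<^sub>F h in at 0. exp_recip k (Suc m) h = (exp_recip k m (0 + h) - exp_recip k m 0) / h"
      by (intro always_eventually allI) (auto simp: exp_recip_def field_simps)
  qed
  then have "(exp_recip k m has_real_derivative 0) (at 0)"
    by (simp add: DERIV_def)
  then show ?thesis using equal by (simp add: exp_recip_def)
next
  case greater
  have "((\<lambda>s. exp (- k / s) / s ^ m) has_real_derivative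
          k * exp_recip k (m + 2) s - m * exp_recip k (m + 1) s) (at s)"
  proof (cases m)
    case 0
    then show ?thesis using greater
      by (auto intro!: derivative_eq_intros simp: exp_recip_def field_simps power2_eq_square)
  next
    case (Suc n)
    have "((\<lambda>s. exp (- k / s) / s ^ Suc n) has_real_derivative
          (exp (- k / s) * (k / s\<^sup>2) * s ^ Suc n - exp (- k / s) * (real (Suc n) * s ^ n)) / (s ^ Suc n * s ^ Suc n)) (at s)"
      using greater
      by (auto intro!: derivative_eq_intros simp: power2_eq_square simp del: power_Suc)
    also have "(exp (- k / s) * (k / s\<^sup>2) * s ^ Suc n - exp (- k / s) * (real (Suc n) * s ^ n)) / (s ^ Suc n * s ^ Suc n)
        = k * exp_recip k (m + 2) s - m * exp_recip k (m + 1) s"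
      using greater Suc by (simp add: exp_recip_def divide_simps power2_eq_square) (simp add: algebra_simps)
    finally show ?thesis by (simp add: Suc)
  qed
  then show ?thesis
    by (rule DERIV_cong_ev[THEN iffD1, rotated -1])
       (use greater in \<open>auto simp: exp_recip_def eventually_nhds intro!: exI[of _ "{0<..}"]\<close>)
qed

text \<open>A bump supported on \<open>[c, d]\<close>. The polynomial factor is what makes the family closed under
  differentiation: by raising all powers to \<open>m + 2\<close>, the derivative is again a single member, and no
  sums are needed.\<close>
definition bump :: "real \<Rightarrow> real \<Rightarrow> real \<Rightarrow> real poly \<Rightarrow> nat \<Rightarrow> real \<Rightarrow> real" where
  "bump k c d p m t = poly p t * exp_recip k m ((t - c) * (d - t))"

lemma exp_recip_raise: "exp_recip k m s = s\<^sup>2 * exp_recip k (m + 2) s"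
  "exp_recip k (m + 1) s = s * exp_recip k (m + 2) s"
  by (auto simp: exp_recip_def field_simps power2_eq_square)

lemma bump_derivative:
  assumes "k > 0"
  shows "\<exists>q. \<forall>t. (bump k c d p m has_real_derivative bump k c d q (m + 2) t) (at t)"
proof -
  define u where "u = [:- (c * d), c + d, -1:]"
  have u: "poly u t = (t - c) * (d - t)" for t
    by (simp add: u_def algebra_simps)
  define q where "q = pderiv p * u\<^sup>2 + smult k (p * pderiv u) - smult (real m) (p * pderiv u * u)"
  have "(bump k c d p m has_real_derivative bump k c d q (m + 2) t) (at t)" for t
  proof -
    have "((\<lambda>t. poly p t * exp_recip k m (poly u t)) has_real_derivative
        poly (pderiv p) t * exp_recip k m (poly u t) +
        (k * exp_recip k (m + 2) (poly u t) - m * exp_recip k (m + 1) (poly u t)) * poly (pderiv u) t * poly p t) (at t)"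
      by (intro DERIV_mult poly_DERIV DERIV_chain2[OF exp_recip_has_derivative[OF assms]])
    also have "poly (pderiv p) t * exp_recip k m (poly u t) +
        (k * exp_recip k (m + 2) (poly u t) - m * exp_recip k (m + 1) (poly u t)) * poly (pderiv u) t * poly p t
      = bump k c d q (m + 2) t"
      unfolding exp_recip_raise(1)[of k m "poly u t"] exp_recip_raise(2)[of k m "poly u t"]
      by (simp add: bump_def q_def flip: u) (simp add: algebra_simps)
    also have "(\<lambda>t. poly p t * exp_recip k m (poly u t)) = bump k c d p m"
      by (simp add: bump_def u fun_eq_iff)
    finally show ?thesis .
  qed
  then show ?thesis by blast
qed

text \<open>A partial derivative changes one factor of the product only, so this family is closed under all
  partial derivatives; smoothness of every order follows by induction on the order.\<close>
definition product_bump ::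
  "real \<Rightarrow> real^'d \<Rightarrow> real^'d \<Rightarrow> ('d \<Rightarrow> real poly) \<Rightarrow> ('d \<Rightarrow> nat) \<Rightarrow> real^'d \<Rightarrow> real" where
  "product_bump k c d p m x = (\<Prod>i\<in>UNIV. bump k (c $ i) (d $ i) (p i) (m i) (x $ i))"

lemma product_bump_partial:
  assumes "k > 0"
  shows "(\<forall>x. product_bump k c d p m differentiable (at x)) \<and>
    (\<exists>q n. partial_deriv j (product_bump k c d p m) = product_bump k c d q n)"
proof -
  have "\<forall>i. \<exists>q. \<forall>t. (bump k (c $ i) (d $ i) (p i) (m i) has_real_derivative bump k (c $ i) (d $ i) q (m i + 2) t) (at t)"
    using bump_derivative[OF assms] by blast
  then obtain q where q: "\<And>i t. (bump k (c $ i) (d $ i) (p i) (m i) has_real_derivative bump k (c $ i) (d $ i) (q i) (m i + 2) t) (at t)"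
    by metis
  let ?b = "\<lambda>i t. bump k (c $ i) (d $ i) (p i) (m i) t"
  let ?b' = "\<lambda>i t. bump k (c $ i) (d $ i) (q i) (m i + 2) t"
  have D: "(product_bump k c d p m has_derivative
      (\<lambda>h. \<Sum>i\<in>UNIV. (h $ i * ?b' i (x $ i)) * (\<Prod>j\<in>UNIV - {i}. ?b j (x $ j)))) (at x)" for x
  proof -
    have "((\<lambda>x. ?b i (x $ i)) has_derivative (\<lambda>h. h $ i * ?b' i (x $ i))) (at x)" for i
      using has_derivative_compose[OF bounded_linear.has_derivative[OF bounded_linear_vec_nth[of i] has_derivative_ident]
          q[of i "x $ i", unfolded has_field_derivative_def]]
      by (simp add: mult.commute)
    then show ?thesis
      unfolding product_bump_def[abs_def] by (intro has_derivative_prod) auto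
  qed
  have "partial_deriv j (product_bump k c d p m) x = product_bump k c d (p(j := q j)) (m(j := m j + 2)) x" for x
  proof -
    have "partial_deriv j (product_bump k c d p m) x
        = (\<Sum>i\<in>UNIV. (axis j 1 $ i * ?b' i (x $ i)) * (\<Prod>j\<in>UNIV - {i}. ?b j (x $ j)))"
      unfolding partial_deriv_def frechet_derivative_at[OF D, symmetric] ..
    also have "\<dots> = (\<Sum>i\<in>UNIV. if i = j then ?b' j (x $ j) * (\<Prod>j\<in>UNIV - {j}. ?b j (x $ j)) else 0)"
      by (rule sum.cong) (auto simp: axis_def)
    also have "\<dots> = ?b' j (x $ j) * (\<Prod>j\<in>UNIV - {j}. ?b j (x $ j))"
      by simp
    also have "\<dots> = product_bump k c d (p(j := q j)) (m(j := m j + 2)) x"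
      unfolding product_bump_def by (subst (2) prod.remove[of _ j]) auto
    finally show ?thesis .
  qed
  then show ?thesis
    using D unfolding differentiable_def by blast
qed

lemma Ck_product_bump:
  assumes "k > 0"
  shows "Ck n (product_bump k c d p m)"
proof (induction n arbitrary: p m)
  case 0
  show ?case
    using product_bump_partial[OF assms, of c d p m]
    by (auto intro!: continuous_at_imp_continuous_on differentiable_imp_continuous_within)
next
  case (Suc n)
  show ?case
    using product_bump_partial[OF assms, of c d p m] Suc by (metis Ck.simps(2))
qed

definition box_bump :: "real \<Rightarrow> real^'d \<Rightarrow> real^'d \<Rightarrow> real^'d \<Rightarrow> real" where
  "box_bump k c d = product_bump k c d (\<lambda>_. 1) (\<lambda>_. 0)"

lemma box_bump_eq:
  fixes c d :: "real^'d"
  assumes "\<forall>i. c $ i < d $ i"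
  shows "box_bump k c d x =
    (if x \<in> box c d then \<Prod>i\<in>UNIV. exp (- k / ((x $ i - c $ i) * (d $ i - x $ i))) else 0)"
proof -
  have pos: "0 < (x $ i - c $ i) * (d $ i - x $ i) \<longleftrightarrow> c $ i < x $ i \<and> x $ i < d $ i" for i
    using assms[rule_format, of i] by (auto simp: zero_less_mult_iff)
  show ?thesis
    by (auto simp: box_bump_def product_bump_def bump_def exp_recip_def pos mem_box_cart)
qed

lemma box_bump_bounds:
  fixes c d :: "real^'d"
  assumes "\<forall>i. c $ i < d $ i" "k > 0"
  shows "0 \<le> box_bump k c d x" "box_bump k c d x \<le> 1"
proof -
  have "(\<Prod>i\<in>UNIV. exp (- k / ((x $ i - c $ i) * (d $ i - x $ i)))) \<le> 1" if "x \<in> box c d"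
    using assms that by (intro prod_le_1) (auto simp: mem_box_cart less_imp_le)
  then show "0 \<le> box_bump k c d x" "box_bump k c d x \<le> 1"
    using assms by (auto simp: box_bump_eq prod_nonneg)
qed

lemma box_bump_test_function:
  fixes c d :: "real^'d"
  assumes "\<forall>i. c $ i < d $ i" "k > 0" "cbox c d \<subseteq> S"
  shows "box_bump k c d \<in> test_functions S"
proof -
  have "{x. box_bump k c d x \<noteq> 0} \<subseteq> cbox c d"
    using assms(1) by (auto simp: box_bump_eq box_subset_cbox[THEN subsetD])
  then have cl: "closure {x. box_bump k c d x \<noteq> 0} \<subseteq> cbox c d"
    by (intro closure_minimal) (auto simp: closed_cbox)
  then have "compact (closure {x. box_bump k c d x \<noteq> 0})"
    by (meson bounded_cbox bounded_subset closed_closure compact_eq_bounded_closed)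
  then show ?thesis
    using cl assms(2,3) Ck_product_bump[OF assms(2)] by (auto simp: test_functions_def box_bump_def)
qed

text \<open>On the open box the exponents \<open>- k / ((x\<^sub>i - c\<^sub>i) (d\<^sub>i - x\<^sub>i))\<close> tend to zero with \<open>k\<close>; outside
  all members vanish.\<close>
lemma box_bump_tendsto_indicator:
  fixes c d :: "real^'d"
  assumes "\<forall>i. c $ i < d $ i"
  shows "(\<lambda>n. box_bump (1 / Suc n) c d x) \<longlonglongrightarrow> indicator (box c d) x"
proof (cases "x \<in> box c d")
  case True
  then have "(x $ i - c $ i) * (d $ i - x $ i) \<noteq> 0" for i
    by (auto simp: mem_box_cart dest: spec[of _ i])
  then have "(\<lambda>n. \<Prod>i\<in>UNIV. exp (- (1 / Suc n) / ((x $ i - c $ i) * (d $ i - x $ i)))) \<longlonglongrightarrow>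
      (\<Prod>i\<in>(UNIV::'d set). exp (- 0 / ((x $ i - c $ i) * (d $ i - x $ i))))"
    by (intro tendsto_intros LIMSEQ_Suc[OF lim_1_over_n])
  then show ?thesis using True assms by (simp add: box_bump_eq)
qed (use assms in \<open>simp add: box_bump_eq\<close>)


section \<open>The fundamental lemma of the calculus of variations\<close>

lemma test_function_continuous:
  assumes "\<eta> \<in> test_functions S"
  shows "continuous_on A \<eta>" "continuous_on A (partial_deriv i \<eta>)"
proof -
  have "Ck 0 \<eta>" "Ck 1 \<eta>" using assms by (auto simp: test_functions_def)
  then have "continuous_on UNIV \<eta>" "continuous_on UNIV (partial_deriv i \<eta>)" by simp_all
  then show "continuous_on A \<eta>" "continuous_on A (partial_deriv i \<eta>)"
    by (auto intro: continuous_on_subset)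
qed

lemma integral_against_box:
  fixes g :: "real^'d \<Rightarrow> real"
  assumes S: "open S" and sub: "cbox c d \<subseteq> S"
    and g: "integrable (lebesgue_on (cbox c d)) g"
    and orth: "\<And>\<eta>. \<eta> \<in> test_functions S \<Longrightarrow> (\<integral>x. g x * \<eta> x \<partial>(lebesgue_on S)) = 0"
  shows "(\<integral>x. indicator (box c d) x * g x \<partial>lebesgue) = 0"
proof (cases "\<forall>i. c $ i < d $ i")
  case False
  then have "box c d = {}" by (auto simp: interval_eq_empty_cart not_less)
  then show ?thesis by simp
next
  case True
  let ?\<eta> = "\<lambda>n::nat. box_bump (1 / Suc n) c d"
  define G where "G x = indicator (cbox c d) x * g x" for x
  have G: "integrable lebesgue G"
    using g by (simp add: integrable_restrict_space G_def[abs_def])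
  have \<eta>: "?\<eta> n \<in> test_functions S" for n
    using True sub by (intro box_bump_test_function) auto
  have meas: "?\<eta> n \<in> borel_measurable lebesgue" for n
    using borel_measurable_continuous_onI[OF test_function_continuous(1)[OF \<eta>]]
    by (simp add: measurable_completion)
  have int0: "(\<integral>x. ?\<eta> n x * G x \<partial>lebesgue) = 0" for n
  proof -
    have "(\<integral>x. ?\<eta> n x * G x \<partial>lebesgue) = (\<integral>x. indicator S x *\<^sub>R (g x * ?\<eta> n x) \<partial>lebesgue)"
      using True sub box_subset_cbox[of c d]
      by (intro Bochner_Integration.integral_cong) (auto simp: G_def box_bump_eq split: split_indicator)
    also have "\<dots> = (\<integral>x. g x * ?\<eta> n x \<partial>(lebesgue_on S))"
      using S by (simp add: integral_restrict_space)
    finally show ?thesis using orth[OF \<eta>] by simp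
  qed
  have "(\<lambda>n. \<integral>x. ?\<eta> n x * G x \<partial>lebesgue) \<longlonglongrightarrow> (\<integral>x. indicator (box c d) x * g x \<partial>lebesgue)"
  proof (rule integral_dominated_convergence[where w = "\<lambda>x. \<bar>G x\<bar>"])
    show "integrable lebesgue (\<lambda>x. \<bar>G x\<bar>)" using G by simp
    show "(\<lambda>x. ?\<eta> n x * G x) \<in> borel_measurable lebesgue" for n
      using meas G by (intro borel_measurable_times) auto
    have "(\<lambda>x. indicator (box c d) x * g x) = (\<lambda>x. indicator (box c d) x * G x)"
      using box_subset_cbox[of c d] by (auto simp: G_def fun_eq_iff split: split_indicator)
    then show "(\<lambda>x. indicator (box c d) x * g x) \<in> borel_measurable lebesgue"
      using G by (simp only: borel_measurable_times borel_measurable_indicator borel_measurable_integrable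
          sets_completionI_sets sets_lborel borel_open open_box)
    show "AE x in lebesgue. (\<lambda>n. ?\<eta> n x * G x) \<longlonglongrightarrow> indicator (box c d) x * g x"
    proof (rule AE_I2)
      fix x
      have eq: "indicator (box c d) x * g x = indicator (box c d) x * G x"
        using box_subset_cbox[of c d] by (auto simp: G_def split: split_indicator)
      show "(\<lambda>n. ?\<eta> n x * G x) \<longlonglongrightarrow> indicator (box c d) x * g x"
        unfolding eq by (intro tendsto_mult_right box_bump_tendsto_indicator True)
    qed
    show "AE x in lebesgue. norm (?\<eta> n x * G x) \<le> \<bar>G x\<bar>" for n
      using box_bump_bounds[OF True, of "1 / Suc n"]
      by (intro AE_I2) (simp add: abs_mult mult_left_le_one_le)
  qed
  then have "(\<lambda>n::nat. 0) \<longlonglongrightarrow> (\<integral>x. indicator (box c d) x * g x \<partial>lebesgue)"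
    unfolding int0 .
  then show ?thesis by (simp add: LIMSEQ_const_iff)
qed

text \<open>Boxes form an intersection-stable generator of the Borel sets. The vanishing total integral gives
  closure under complements, so the integral vanishes over every Borel set.\<close>
lemma AE_zero_if_box_integrals_zero:
  fixes G :: "'a::euclidean_space \<Rightarrow> real"
  assumes G: "integrable lebesgue G"
    and total: "(\<integral>x. G x \<partial>lebesgue) = 0"
    and boxes: "\<And>c d. (\<integral>x. indicator (box c d) x * G x \<partial>lebesgue) = 0"
  shows "AE x in lebesgue. G x = 0"
proof -
  \<comment> \<open>The generator argument lives on the Borel sets, so \<open>G\<close> is replaced by a Borel representative.\<close>
  obtain g where g[measurable]: "g \<in> borel_measurable lborel" and eq: "AE x in lborel. G x = g x"
    using completion_ex_borel_measurable_real[of G lborel] G by auto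
  have eqL: "AE x in lebesgue. G x = g x" using eq by (rule AE_completion)
  have gm: "g \<in> borel_measurable lebesgue" by (simp add: measurable_completion)
  have gi: "integrable lborel g"
    using integrable_cong_AE_imp[OF G gm] eqL by (simp add: integrable_completion AE_symmetric)
  have box: "(\<integral>x. indicator (box c d) x * g x \<partial>lborel) = 0" for c d
  proof -
    have "(\<integral>x. indicator (box c d) x * g x \<partial>lborel) = (\<integral>x. indicator (box c d) x * g x \<partial>lebesgue)"
      by (simp add: integral_completion)
    also have "\<dots> = (\<integral>x. indicator (box c d) x * G x \<partial>lebesgue)"
      using eqL G gm by (intro integral_cong_AE borel_measurable_times borel_measurable_indicator) auto
    finally show ?thesis using boxes by simp
  qed
  have tot: "(\<integral>x. g x \<partial>lborel) = 0"
  proof -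
    have "(\<integral>x. g x \<partial>lborel) = (\<integral>x. g x \<partial>lebesgue)"
      by (simp add: integral_completion)
    also have "\<dots> = (\<integral>x. G x \<partial>lebesgue)"
      using eqL G gm by (intro integral_cong_AE) auto
    finally show ?thesis using total by simp
  qed
  have "AE x in lborel. g x = 0"
  proof (rule sigma_finite_measure.density_zero[OF sigma_finite_lborel gi])
    fix A :: "'a set" assume "A \<in> sets lborel"
    then have A: "A \<in> sigma_sets UNIV (range (\<lambda>(a, b). box a b :: 'a set))"
      by (simp add: borel_eq_box)
    have int_stable: "Int_stable (range (\<lambda>(a, b). box a b :: 'a set))"
      by (auto simp: Int_stable_def box_Int_box)
    have sub: "range (\<lambda>(a, b). box a b :: 'a set) \<subseteq> Pow UNIV" by simp
    have "(\<integral>x. indicator A x * g x \<partial>lborel) = 0"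
      using int_stable sub A
    proof (induction rule: sigma_sets_induct_disjoint)
      case (basic A)
      then obtain c d where "A = box c d" by auto
      then show ?case using box by simp
    next
      case empty
      show ?case by simp
    next
      case (compl A)
      then have "A \<in> sets borel" by (simp add: borel_eq_box)
      then have "integrable lborel (\<lambda>x. indicator A x * g x)"
        using integrable_mult_indicator[OF _ gi, of A] by simp
      then have "(\<integral>x. g x - indicator A x * g x \<partial>lborel) = 0"
        using Bochner_Integration.integral_diff[OF gi] compl.IH tot by simp
      also have "(\<lambda>x. g x - indicator A x * g x) = (\<lambda>x. indicator (UNIV - A) x * g x)"
        by (auto simp: fun_eq_iff split: split_indicator)
      finally show ?case .
    next
      case (union A)
      then have Am: "A i \<in> sets lborel" for i by (auto simp: borel_eq_box)
      have "set_lebesgue_integral lborel (\<Union>i. A i) g = (\<Sum>i. set_lebesgue_integral lborel (A i) g)"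
      proof (rule lebesgue_integral_countable_add[OF Am])
        show "A i \<inter> A j = {}" if "i \<noteq> j" for i j
          using union(1) that by (auto simp: disjoint_family_on_def)
        show "set_integrable lborel (\<Union>i. A i) g"
          using Am unfolding set_integrable_def by (intro integrable_mult_indicator gi) auto
      qed
      then show ?case using union by (simp add: set_lebesgue_integral_def)
    qed
    then show "set_lebesgue_integral lborel A g = 0"
      by (simp add: set_lebesgue_integral_def)
  qed
  then have "AE x in lebesgue. g x = 0" by (rule AE_completion)
  then show ?thesis using eqL by eventually_elim simp
qed

text \<open>Testing with the bumps and letting them tend to the indicator yields a vanishing integral over
  every box whose closure lies in \<open>S\<close>. Inside one such box the previous lemma applies, and countably
  many of them cover \<open>S\<close>.\<close>
theorem fundamental_lemma_calculus_of_variations: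
  fixes g :: "real^'d \<Rightarrow> real"
  assumes S: "open S"
    and g: "\<And>c d. cbox c d \<subseteq> S \<Longrightarrow> integrable (lebesgue_on (cbox c d)) g"
    and orth: "\<And>\<eta>. \<eta> \<in> test_functions S \<Longrightarrow> (\<integral>x. g x * \<eta> x \<partial>(lebesgue_on S)) = 0"
  shows "AE x in lebesgue. x \<in> S \<longrightarrow> g x = 0"
proof -
  have ae: "AE x in lebesgue. x \<in> box p q \<longrightarrow> g x = 0" if pq: "cbox p q \<subseteq> S" for p q
  proof -
    define G where "G x = indicator (box p q) x * g x" for x
    have "integrable lebesgue (\<lambda>x. indicator (cbox p q) x * g x)"
      using g[OF pq] by (simp add: integrable_restrict_space)
    from integrable_mult_indicator[OF _ this, of "box p q"]
    have "integrable lebesgue (\<lambda>x. indicator (box p q) x *\<^sub>R (indicator (cbox p q) x * g x))"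
      by simp
    moreover have "indicator (box p q) x *\<^sub>R (indicator (cbox p q) x * g x) = G x" for x
      using box_subset_cbox[of p q] by (auto simp: G_def split: split_indicator)
    ultimately have G: "integrable lebesgue G" by simp
    have box0: "(\<integral>x. indicator (box c d) x * G x \<partial>lebesgue) = 0" for c d
    proof (cases "box c d \<inter> box p q = {}")
      case True
      then have "(\<lambda>x. indicator (box c d) x * G x) = (\<lambda>x. 0)"
        by (auto simp: G_def fun_eq_iff split: split_indicator)
      then show ?thesis by simp
    next
      case False
      obtain c' d' where cd: "box c d \<inter> box p q = box c' d'" using box_Int_box[of c d p q] by blast
      then have "cbox c' d' \<subseteq> cbox p q"
        using False closure_mono[of "box c' d'" "box p q"] by (metis Int_empty_right Int_lower2 closure_box)
      then have sub: "cbox c' d' \<subseteq> S" using pq by auto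
      have "indicator (box c d) x * G x = indicator (box c' d') x * g x" for x
        using cd by (auto simp: G_def split: split_indicator)
      then show ?thesis
        using integral_against_box[OF S sub g[OF sub] orth] by simp
    qed
    have "(\<integral>x. indicator (box p q) x * G x \<partial>lebesgue) = (\<integral>x. G x \<partial>lebesgue)"
      by (intro Bochner_Integration.integral_cong) (auto simp: G_def split: split_indicator)
    then have "AE x in lebesgue. G x = 0"
      using box0[of p q] by (intro AE_zero_if_box_integrals_zero[OF G _ box0]) simp
    then show ?thesis by eventually_elim (auto simp: G_def)
  qed
  define \<F> where "\<F> = {box p q |p q. cbox p q \<subseteq> S}"
  have "\<Union>\<F> = S"
  proof
    show "\<Union>\<F> \<subseteq> S" using box_subset_cbox by (auto simp: \<F>_def)
    show "S \<subseteq> \<Union>\<F>"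
    proof
      fix x assume "x \<in> S"
      then obtain p q where "cbox p q \<subseteq> S" "x \<in> box p q"
        using open_contains_cbox[OF S] by metis
      then show "x \<in> \<Union>\<F>" by (auto simp: \<F>_def)
    qed
  qed
  moreover obtain \<F>' where \<F>': "\<F>' \<subseteq> \<F>" "countable \<F>'" "\<Union>\<F>' = \<Union>\<F>"
    using Lindelof[of \<F>] by (auto simp: \<F>_def)
  ultimately have "S = \<Union>\<F>'" by simp
  have "AE x in lebesgue. \<forall>B\<in>\<F>'. x \<in> B \<longrightarrow> g x = 0"
    using \<F>'(1) ae by (subst AE_ball_countable[OF \<F>'(2)]) (auto simp: \<F>_def)
  then show ?thesis
    by eventually_elim (use \<open>S = \<Union>\<F>'\<close> in blast)
qed


section \<open>Weak gradients\<close>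

lemma L2_mono:
  assumes "u \<in> L2 S" "T \<subseteq> S" "S \<in> sets lebesgue" "T \<in> sets lebesgue"
  shows "u \<in> L2 T"
proof -
  have eq: "lebesgue_on T = restrict_space (lebesgue_on S) T"
    using assms(2-4) by (subst restrict_restrict_space) (auto simp: Int_absorb1)
  have T: "T \<in> sets (lebesgue_on S)"
    using assms by (simp add: sets_restrict_space_iff)
  have "u \<in> borel_measurable (lebesgue_on T)"
    unfolding eq using L2_measurable[OF assms(1)] by (rule measurable_restrict_space1)
  moreover have "integrable (lebesgue_on T) (\<lambda>x. (norm (u x))\<^sup>2)"
    unfolding eq using T integrable_mult_indicator[OF T L2_integrable_norm_sq[OF assms(1)]]
    by (subst integrable_restrict_space) (auto simp: sets.Int_space_eq2)
  ultimately show ?thesis by (simp add: L2_def)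
qed

lemma L2_subset_L2loc: "S \<in> sets lebesgue \<Longrightarrow> L2 S \<subseteq> L2loc S"
  using L2_mono[OF _ _ _ lmeasurable_compact[THEN fmeasurableD]] by (fastforce simp: L2loc_def)

lemma L2loc_compact: "\<lbrakk>u \<in> L2loc S; compact K; K \<subseteq> S\<rbrakk> \<Longrightarrow> u \<in> L2 K"
  by (simp add: L2loc_def)

lemma subspace_L2loc: "subspace (L2loc S)"
  using subspace_L2 by (fastforce simp: subspace_def L2loc_def)

lemma continuous_L2:
  fixes f :: "real^'d \<Rightarrow> 'b::euclidean_space"
  assumes K: "compact K" and f: "continuous_on K f"
  shows "f \<in> L2 K"
proof -
  have Km: "K \<in> sets lebesgue" "emeasure lebesgue K < \<infinity>"
    using lmeasurable_compact[OF K] by (auto simp: fmeasurable_def)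
  have m: "f \<in> borel_measurable (lebesgue_on K)"
    using f Km by (simp add: continuous_imp_measurable_on_sets_lebesgue)
  obtain B where B: "\<And>x. x \<in> K \<Longrightarrow> norm (f x) \<le> B"
    using compact_imp_bounded[OF compact_continuous_image[OF f K]] by (auto simp: bounded_iff)
  have "integrable (lebesgue_on K) (\<lambda>x. (norm (f x))\<^sup>2)"
  proof (rule finite_measure.integrable_const_bound[where B = "B\<^sup>2"])
    show "finite_measure (lebesgue_on K)"
      using Km by (intro finite_measureI) (simp add: emeasure_restrict_space space_restrict_space)
    show "AE x in lebesgue_on K. norm ((norm (f x))\<^sup>2) \<le> B\<^sup>2"
      using B by (intro AE_I2) (auto simp: space_restrict_space intro!: power_mono)
    show "(\<lambda>x. (norm (f x))\<^sup>2) \<in> borel_measurable (lebesgue_on K)" using m by measurable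
  qed
  then show ?thesis using m by (simp add: L2_def)
qed

lemma partial_deriv_eq_0:
  assumes "x \<notin> closure {x. \<eta> x \<noteq> 0}"
  shows "partial_deriv i \<eta> x = 0"
proof -
  have "((\<lambda>_. 0) has_derivative (\<lambda>_. 0)) (at x)" by simp
  then have "(\<eta> has_derivative (\<lambda>_. 0)) (at x)"
  proof (rule has_derivative_transform_within_open)
    show "open (- closure {x. \<eta> x \<noteq> 0})" by (intro open_Compl closed_closure)
    show "x \<in> - closure {x. \<eta> x \<noteq> 0}" using assms by simp
    show "0 = \<eta> y" if "y \<in> - closure {x. \<eta> x \<noteq> 0}" for y
      using that closure_subset[of "{x. \<eta> x \<noteq> 0}"] by auto
  qed
  then show ?thesis
    unfolding partial_deriv_def frechet_derivative_at[symmetric] by (simp add: frechet_derivative_at[symmetric])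
qed

lemma integral_support:
  fixes f :: "real^'d \<Rightarrow> real"
  assumes "K \<subseteq> S" "S \<in> sets lebesgue" "K \<in> sets lebesgue" "\<And>x. x \<notin> K \<Longrightarrow> f x = 0"
  shows "(\<integral>x. f x \<partial>(lebesgue_on S)) = (\<integral>x. f x \<partial>(lebesgue_on K))"
proof -
  have "(\<lambda>x. indicator S x *\<^sub>R f x) = (\<lambda>x. indicator K x *\<^sub>R f x)"
    using assms(1,4) by (auto simp: fun_eq_iff split: split_indicator)
  then show ?thesis using assms(2,3) by (simp add: integral_restrict_space)
qed

text \<open>Both sides of the definition of a weak gradient are \<open>L\<^sup>2\<close> inner products over the compact support
  of the test function. This makes linearity and passage to the limit consequences of the inner
  product structure, also for functions that are only locally square-integrable.\<close>
lemma weak_gradient_integrals: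
  assumes S: "open S" and \<eta>: "\<eta> \<in> test_functions S"
  defines "K \<equiv> closure {x. \<eta> x \<noteq> 0}"
  shows "compact K" "K \<subseteq> S"
    "partial_deriv i \<eta> \<in> L2 K" "(\<lambda>x. axis i (\<eta> x)) \<in> L2 K"
    "(\<integral>x. u x * partial_deriv i \<eta> x \<partial>(lebesgue_on S)) = L2_inner K u (partial_deriv i \<eta>)"
    "(\<integral>x. g x $ i * \<eta> x \<partial>(lebesgue_on S)) = L2_inner K g (\<lambda>x. axis i (\<eta> x))"
proof -
  show K: "compact K" "K \<subseteq> S" using \<eta> by (auto simp: test_functions_def K_def)
  have Km: "K \<in> sets lebesgue" using lmeasurable_compact[OF K(1)] by (rule fmeasurableD)
  show "partial_deriv i \<eta> \<in> L2 K"
    by (intro continuous_L2 K test_function_continuous[OF \<eta>])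
  have "(\<lambda>x. axis i (\<eta> x)) = (\<lambda>x. \<eta> x *\<^sub>R axis i 1)"
    by (auto simp: axis_def vec_eq_iff fun_eq_iff)
  then have "continuous_on K (\<lambda>x. axis i (\<eta> x))"
    using test_function_continuous(1)[OF \<eta>, of K]
    by (simp only:) (intro continuous_on_scaleR continuous_on_const)
  then show "(\<lambda>x. axis i (\<eta> x)) \<in> L2 K" by (intro continuous_L2 K)
  show "(\<integral>x. u x * partial_deriv i \<eta> x \<partial>(lebesgue_on S)) = L2_inner K u (partial_deriv i \<eta>)"
    using S K Km by (subst integral_support[of K]) (auto simp: L2_inner_def K_def partial_deriv_eq_0)
  show "(\<integral>x. g x $ i * \<eta> x \<partial>(lebesgue_on S)) = L2_inner K g (\<lambda>x. axis i (\<eta> x))"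
    using S K Km closure_subset[of "{x. \<eta> x \<noteq> 0}"]
    by (subst integral_support[of K]) (auto simp: L2_inner_def K_def inner_axis)
qed

lemma has_weak_gradient_alt:
  assumes "open S"
  shows "has_weak_gradient S u g \<longleftrightarrow> (\<forall>\<eta>\<in>test_functions S. \<forall>i.
    L2_inner (closure {x. \<eta> x \<noteq> 0}) u (partial_deriv i \<eta>) =
    - L2_inner (closure {x. \<eta> x \<noteq> 0}) g (\<lambda>x. axis i (\<eta> x)))"
  using weak_gradient_integrals(5,6)[OF assms] by (auto simp: has_weak_gradient_def)

lemma has_weak_gradient_add:
  assumes "open S" "u \<in> L2loc S" "v \<in> L2loc S" "g \<in> L2loc S" "h \<in> L2loc S"
    "has_weak_gradient S u g" "has_weak_gradient S v h"
  shows "has_weak_gradient S (u + v) (g + h)"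
  unfolding has_weak_gradient_alt[OF assms(1)]
proof (intro ballI allI)
  fix \<eta> i assume \<eta>: "\<eta> \<in> test_functions S"
  note w = weak_gradient_integrals[OF assms(1) \<eta>]
  let ?K = "closure {x. \<eta> x \<noteq> 0}"
  have "L2_inner ?K (u + v) (partial_deriv i \<eta>) = L2_inner ?K u (partial_deriv i \<eta>) + L2_inner ?K v (partial_deriv i \<eta>)"
    by (intro L2.add_left L2loc_compact[OF _ w(1,2)] w assms)
  moreover have "L2_inner ?K (g + h) (\<lambda>x. axis i (\<eta> x)) = L2_inner ?K g (\<lambda>x. axis i (\<eta> x)) + L2_inner ?K h (\<lambda>x. axis i (\<eta> x))"
    by (intro L2.add_left L2loc_compact[OF _ w(1,2)] w assms)
  ultimately show "L2_inner ?K (u + v) (partial_deriv i \<eta>) = - L2_inner ?K (g + h) (\<lambda>x. axis i (\<eta> x))"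
    using assms(6,7) \<eta> unfolding has_weak_gradient_alt[OF assms(1)] by simp
qed

lemma has_weak_gradient_scale:
  assumes "has_weak_gradient S u g"
  shows "has_weak_gradient S (c *\<^sub>R u) (c *\<^sub>R g)"
  using assms by (simp add: has_weak_gradient_def mult.assoc)

lemma has_weak_gradient_limit:
  assumes S: "open S" and u: "\<And>n::nat. u n \<in> L2loc S" "u' \<in> L2loc S" and g: "\<And>n. g n \<in> L2loc S" "g' \<in> L2loc S"
    and wg: "\<And>n. has_weak_gradient S (u n) (g n)"
    and lim_u: "\<And>K. \<lbrakk>compact K; K \<subseteq> S\<rbrakk> \<Longrightarrow> (\<lambda>n. L2_inner K (u n - u') (u n - u')) \<longlonglongrightarrow> 0"
    and lim_g: "\<And>K. \<lbrakk>compact K; K \<subseteq> S\<rbrakk> \<Longrightarrow> (\<lambda>n. L2_inner K (g n - g') (g n - g')) \<longlonglongrightarrow> 0"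
  shows "has_weak_gradient S u' g'"
  unfolding has_weak_gradient_alt[OF S]
proof (intro ballI allI)
  fix \<eta> i assume \<eta>: "\<eta> \<in> test_functions S"
  note w = weak_gradient_integrals[OF S \<eta>]
  let ?K = "closure {x. \<eta> x \<noteq> 0}"
  have 1: "(\<lambda>n. L2_inner ?K (u n) (partial_deriv i \<eta>)) \<longlonglongrightarrow> L2_inner ?K u' (partial_deriv i \<eta>)"
    by (intro L2.ip_tendsto L2loc_compact[OF _ w(1,2)] w u lim_u)
  have 2: "(\<lambda>n. - L2_inner ?K (g n) (\<lambda>x. axis i (\<eta> x))) \<longlonglongrightarrow> - L2_inner ?K g' (\<lambda>x. axis i (\<eta> x))"
    by (intro tendsto_minus L2.ip_tendsto L2loc_compact[OF _ w(1,2)] w g lim_g)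
  have "L2_inner ?K (u n) (partial_deriv i \<eta>) = - L2_inner ?K (g n) (\<lambda>x. axis i (\<eta> x))" for n
    using wg \<eta> unfolding has_weak_gradient_alt[OF S] by blast
  then show "L2_inner ?K u' (partial_deriv i \<eta>) = - L2_inner ?K g' (\<lambda>x. axis i (\<eta> x))"
    using 1 2 by (simp add: LIMSEQ_unique)
qed

lemma has_weak_gradient_cong_AE:
  assumes S: "S \<in> sets lebesgue"
    and m: "u \<in> borel_measurable (lebesgue_on S)" "v \<in> borel_measurable (lebesgue_on S)"
      "g \<in> borel_measurable (lebesgue_on S)" "h \<in> borel_measurable (lebesgue_on S)"
    and ae: "AE x in lebesgue_on S. u x = v x" "AE x in lebesgue_on S. g x = h x"
    and wg: "has_weak_gradient S u g"
  shows "has_weak_gradient S v h"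
  unfolding has_weak_gradient_def
proof (intro ballI allI)
  fix \<eta> i assume \<eta>: "\<eta> \<in> test_functions S"
  have [measurable]: "\<eta> \<in> borel_measurable (lebesgue_on S)" "partial_deriv i \<eta> \<in> borel_measurable (lebesgue_on S)"
    using S test_function_continuous[OF \<eta>] by (auto intro: continuous_imp_measurable_on_sets_lebesgue)
  note [measurable] = m
  have comp: "(\<lambda>x. f x $ i) \<in> borel_measurable (lebesgue_on S)" if "f \<in> borel_measurable (lebesgue_on S)" for f :: "real^'a \<Rightarrow> real^'a"
    using borel_measurable_inner[OF that borel_measurable_const[of "axis i 1"]] by (simp add: inner_axis)
  have "(\<integral>x. v x * partial_deriv i \<eta> x \<partial>(lebesgue_on S)) = (\<integral>x. u x * partial_deriv i \<eta> x \<partial>(lebesgue_on S))"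
    using ae(1) by (intro integral_cong_AE) auto
  moreover have "(\<integral>x. h x $ i * \<eta> x \<partial>(lebesgue_on S)) = (\<integral>x. g x $ i * \<eta> x \<partial>(lebesgue_on S))"
    using ae(2) comp[OF m(3)] comp[OF m(4)] by (intro integral_cong_AE) auto
  ultimately show "(\<integral>x. v x * partial_deriv i \<eta> x \<partial>(lebesgue_on S)) = - (\<integral>x. h x $ i * \<eta> x \<partial>(lebesgue_on S))"
    using wg \<eta> by (simp add: has_weak_gradient_def)
qed

theorem weak_gradient_unique:
  assumes S: "open S" and g: "g \<in> L2loc S" and h: "h \<in> L2loc S"
    and wg: "has_weak_gradient S u g" "has_weak_gradient S u h"
  shows "AE x in lebesgue_on S. g x = h x"
proof -
  have gh: "g - h \<in> L2loc S" using subspace_diff[OF subspace_L2loc g h] .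
  have "AE x in lebesgue. x \<in> S \<longrightarrow> g x $ i - h x $ i = 0" for i
  proof (rule fundamental_lemma_calculus_of_variations[OF S])
    fix c d :: "real^'a" assume sub: "cbox c d \<subseteq> S"
    have "(\<lambda>x. axis i (1::real) :: real^'a) \<in> L2 (cbox c d)"
      by (intro continuous_L2 compact_cbox continuous_intros)
    from L2_inner_integrable[OF L2loc_compact[OF gh compact_cbox sub] this]
    show "integrable (lebesgue_on (cbox c d)) (\<lambda>x. g x $ i - h x $ i)"
      by (simp add: inner_axis)
  next
    fix \<eta> assume \<eta>: "\<eta> \<in> test_functions S"
    note w = weak_gradient_integrals[OF S \<eta>]
    let ?K = "closure {x. \<eta> x \<noteq> 0}"
    have "(\<integral>x. (g x $ i - h x $ i) * \<eta> x \<partial>(lebesgue_on S)) = L2_inner ?K (g - h) (\<lambda>x. axis i (\<eta> x))"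
      using w(6)[of "g - h" i] by simp
    also have "\<dots> = L2_inner ?K g (\<lambda>x. axis i (\<eta> x)) - L2_inner ?K h (\<lambda>x. axis i (\<eta> x))"
      by (intro L2.diff_left L2loc_compact[OF _ w(1,2)] w g h)
    also have "\<dots> = 0"
      using wg \<eta> unfolding has_weak_gradient_alt[OF S] by (metis diff_self minus_equation_iff)
    finally show "(\<integral>x. (g x $ i - h x $ i) * \<eta> x \<partial>(lebesgue_on S)) = 0" .
  qed
  then have "AE x in lebesgue. \<forall>i\<in>UNIV. x \<in> S \<longrightarrow> g x $ i - h x $ i = 0"
    by (intro AE_finite_allI) auto
  then have "AE x in lebesgue. x \<in> S \<longrightarrow> g x = h x"
    by eventually_elim (simp add: vec_eq_iff)
  then show ?thesis using S by (simp add: AE_restrict_space_iff)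
qed

lemma weak_grad:
  assumes "u \<in> H1 S"
  shows "weak_grad S u \<in> L2 S" "has_weak_gradient S u (weak_grad S u)"
  using someI_ex[of "\<lambda>g. g \<in> L2 S \<and> has_weak_gradient S u g"] assms
  by (auto simp: H1_def weak_grad_def)

lemma weak_grad_AE_eq:
  assumes S: "open S" and g: "g \<in> L2 S" and u: "u \<in> L2 S" "has_weak_gradient S u g"
  shows "AE x in lebesgue_on S. weak_grad S u x = g x"
proof -
  have "S \<in> sets lebesgue" using S by simp
  then have loc: "f \<in> L2loc S" if "f \<in> L2 S" for f :: "real^'a \<Rightarrow> real^'a"
    using that L2_subset_L2loc by blast
  have "u \<in> H1 S" using assms by (auto simp: H1_def)
  from weak_grad[OF this] show ?thesis
    by (intro weak_gradient_unique[OF S]) (auto intro: loc g u)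
qed


section \<open>Periodic extension from the cell\<close>

lemma lebesgue_shift:
  fixes t :: "'a::euclidean_space"
  shows "(\<lambda>x. x + t) \<in> lebesgue \<rightarrow>\<^sub>M lebesgue" "distr lebesgue lebesgue (\<lambda>x. x + t) = lebesgue"
proof -
  have eq: "(\<lambda>x. t + (\<Sum>j\<in>Basis. (1 * (x \<bullet> j)) *\<^sub>R j)) = (\<lambda>x. x + t)"
    by (simp add: fun_eq_iff euclidean_representation)
  show "(\<lambda>x. x + t) \<in> lebesgue \<rightarrow>\<^sub>M lebesgue"
    using lebesgue_affine_measurable[of "\<lambda>_. 1" t] unfolding eq by simp
  show "distr lebesgue lebesgue (\<lambda>x. x + t) = lebesgue"
    using lebesgue_affine_euclidean[of "\<lambda>_. 1" t] unfolding eq by (simp add: density_1)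
qed

lemma AE_lebesgue_shift:
  assumes "AE x in lebesgue. Q x"
  shows "AE x in lebesgue. Q (x + t)"
  by (rule AE_distrD[OF lebesgue_shift(1)]) (simp only: lebesgue_shift(2) assms)

lemma integral_lebesgue_shift:
  fixes f :: "'a::euclidean_space \<Rightarrow> 'b::{banach, second_countable_topology}"
  assumes f: "f \<in> borel_measurable lebesgue"
  shows "(\<integral>x. f (x + t) \<partial>lebesgue) = (\<integral>x. f x \<partial>lebesgue)"
    "integrable lebesgue (\<lambda>x. f (x + t)) \<longleftrightarrow> integrable lebesgue f"
    "(\<lambda>x. f (x + t)) \<in> borel_measurable lebesgue"
  using integral_distr[OF lebesgue_shift(1)[of t] f] integrable_distr_eq[OF lebesgue_shift(1)[of t] f]
    measurable_compose[OF lebesgue_shift(1)[of t] f]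
  by (simp_all add: lebesgue_shift(2))

lemma test_function_shift:
  fixes t :: "real^'d"
  assumes "\<eta> \<in> test_functions UNIV"
  shows "(\<lambda>x. \<eta> (x + t)) \<in> test_functions UNIV" "partial_deriv i (\<lambda>x. \<eta> (x + t)) x = partial_deriv i \<eta> (x + t)"
proof -
  have deriv: "((\<lambda>x. f (x + t)) has_derivative f') (at x)" if "(f has_derivative f') (at (x + t))"
    for f :: "real^'d \<Rightarrow> real" and f' x
    using has_derivative_compose[OF has_derivative_add[OF has_derivative_ident has_derivative_const] that] by simp
  have pd: "partial_deriv i (\<lambda>x. f (x + t)) = (\<lambda>x. partial_deriv i f (x + t))"
    if "\<forall>x. f differentiable (at x)" for f :: "real^'d \<Rightarrow> real" and i
  proof
    fix x
    have "(f has_derivative frechet_derivative f (at (x + t))) (at (x + t))"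
      using that frechet_derivative_works by blast
    from frechet_derivative_at[OF deriv[OF this]]
    show "partial_deriv i (\<lambda>x. f (x + t)) x = partial_deriv i f (x + t)"
      by (simp add: partial_deriv_def)
  qed
  have Ck: "Ck k (\<lambda>x. f (x + t))" if "Ck k f" for k and f :: "real^'d \<Rightarrow> real"
    using that
  proof (induction k arbitrary: f)
    case 0
    then show ?case
      by (auto intro!: continuous_on_compose2[of UNIV f] continuous_intros)
  next
    case (Suc k)
    then have diff: "\<forall>x. f differentiable (at x)" by simp
    then have "\<forall>x. (\<lambda>x. f (x + t)) differentiable (at x)"
      using deriv unfolding differentiable_def by blast
    then show ?case using Suc by (simp add: pd[OF diff])
  qed
  have "closure {x. \<eta> (x + t) \<noteq> 0} = (+) (- t) ` closure {x. \<eta> x \<noteq> 0}"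
  proof -
    have "{x. \<eta> (x + t) \<noteq> 0} = (+) (- t) ` {x. \<eta> x \<noteq> 0}"
      by (force simp: image_iff)
    then show ?thesis by (simp only: closure_translation)
  qed
  moreover have "compact (closure {x. \<eta> x \<noteq> 0})"
    using assms unfolding test_functions_def by blast
  ultimately have "compact (closure {x. \<eta> (x + t) \<noteq> 0})"
    by (simp only: compact_translation)
  then show "(\<lambda>x. \<eta> (x + t)) \<in> test_functions UNIV"
    using assms Ck by (simp add: test_functions_def)
  have "Ck 1 \<eta>" using assms by (simp add: test_functions_def)
  then have "\<forall>x. \<eta> differentiable (at x)" by simp
  then show "partial_deriv i (\<lambda>x. \<eta> (x + t)) x = partial_deriv i \<eta> (x + t)"
    by (simp add: pd)
qed

lemma L2loc_measurable:
  assumes "u \<in> L2loc (UNIV :: (real^'d) set)"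
  shows "u \<in> borel_measurable lebesgue"
proof -
  let ?u = "\<lambda>n x. if x \<in> cball 0 (real n) then u x else 0"
  have "?u n \<in> borel_measurable lebesgue" for n
    using L2_measurable[OF L2loc_compact[OF assms, of "cball 0 (real n)"]]
    by (intro borel_measurable_if_I) auto
  moreover have "(\<lambda>n. ?u n x) \<longlonglongrightarrow> u x" for x
  proof (rule tendsto_eventually)
    obtain N :: nat where "norm x \<le> N" using real_arch_simple by blast
    then show "\<forall>\<^sub>F n in sequentially. ?u n x = u x"
      by (auto simp: eventually_sequentially intro!: exI[of _ N])
  qed
  ultimately show ?thesis by (rule borel_measurable_LIMSEQ_metric)
qed

text \<open>The shifted function \<open>G (x + t)\<close> is a weak gradient of the shifted, hence of the same, \<open>v\<close>; this is
  a change of variables that moves the shift onto the test function. Uniqueness does the rest.\<close>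
theorem weak_gradient_shift_invariant:
  fixes v :: "real^'d \<Rightarrow> real" and G :: "real^'d \<Rightarrow> real^'d"
  assumes v: "v \<in> L2loc UNIV" "\<And>x. v (x + t) = v x"
    and G: "G \<in> L2loc UNIV" "has_weak_gradient UNIV v G"
  shows "AE x in lebesgue. G (x + t) = G x"
proof -
  let ?G = "\<lambda>x. G (x + t)"
  have "has_weak_gradient UNIV v ?G"
    unfolding has_weak_gradient_def
  proof (intro ballI allI)
    fix \<eta> i assume \<eta>: "\<eta> \<in> test_functions (UNIV :: (real^'d) set)"
    note s = test_function_shift[OF \<eta>, where t = "- t"]
    have mG: "G \<in> borel_measurable lebesgue" and mv: "v \<in> borel_measurable lebesgue"
      using L2loc_measurable G v by auto
    have mGi: "(\<lambda>x. G x $ i) \<in> borel_measurable lebesgue"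
      using borel_measurable_inner[OF mG borel_measurable_const[of "axis i 1"]] by (simp add: inner_axis)
    have mc: "f \<in> borel_measurable lebesgue" if "continuous_on UNIV f" for f :: "real^'d \<Rightarrow> real"
      using borel_measurable_continuous_onI[OF that] by (simp add: measurable_completion)
    have pe: "partial_deriv i (\<lambda>x. \<eta> (x + - t)) = (\<lambda>x. partial_deriv i \<eta> (x + - t))"
      by (intro ext) (rule s(2))
    have mp: "(\<lambda>x. v x * partial_deriv i \<eta> (x + - t)) \<in> borel_measurable lebesgue"
      using mv mc[OF test_function_continuous(2)[OF s(1), of _ i]] unfolding pe
      by (intro borel_measurable_times)
    have "(\<integral>x. ?G x $ i * \<eta> x \<partial>lebesgue) = (\<integral>x. G (x + t) $ i * \<eta> (x + t + - t) \<partial>lebesgue)"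
      by simp
    also have "\<dots> = (\<integral>x. G x $ i * \<eta> (x + - t) \<partial>lebesgue)"
      using mGi mc[OF test_function_continuous(1)[OF s(1)]]
      by (intro integral_lebesgue_shift(1)) (intro borel_measurable_times)
    also have "\<dots> = - (\<integral>x. v x * partial_deriv i (\<lambda>x. \<eta> (x + - t)) x \<partial>lebesgue)"
      using G(2) s(1) by (simp add: has_weak_gradient_def lebesgue_on_UNIV_eq)
    also have "\<dots> = - (\<integral>x. v x * partial_deriv i \<eta> (x + - t) \<partial>lebesgue)"
      by (simp only: pe)
    also have "\<dots> = - (\<integral>x. v (x + t) * partial_deriv i \<eta> (x + t + - t) \<partial>lebesgue)"
      by (simp only: integral_lebesgue_shift(1)[OF mp])
    also have "\<dots> = - (\<integral>x. v x * partial_deriv i \<eta> x \<partial>lebesgue)"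
      using v(2) by simp
    finally show "(\<integral>x. v x * partial_deriv i \<eta> x \<partial>(lebesgue_on UNIV)) = - (\<integral>x. ?G x $ i * \<eta> x \<partial>(lebesgue_on UNIV))"
      by (simp add: lebesgue_on_UNIV_eq)
  qed
  moreover have "?G \<in> L2loc UNIV"
    unfolding L2loc_def
  proof (intro CollectI allI impI)
    fix K :: "(real^'d) set" assume K: "compact K \<and> K \<subseteq> UNIV"
    let ?K = "(\<lambda>x. x + t) ` K"
    have c: "compact ?K" using K compact_translation[of K t] by (simp add: add.commute)
    have Km: "K \<in> sets lebesgue" "?K \<in> sets lebesgue"
      using K c lmeasurable_compact by (auto dest: fmeasurableD)
    have "integrable lebesgue (\<lambda>x. indicator ?K x * (norm (G x))\<^sup>2)"
      using L2_integrable_norm_sq[OF L2loc_compact[OF G(1) c]] Km by (simp add: integrable_restrict_space)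
    then have "integrable lebesgue (\<lambda>x. indicator ?K (x + t) * (norm (G (x + t)))\<^sup>2)"
      using integral_lebesgue_shift(2)[of "\<lambda>x. indicator ?K x * (norm (G x))\<^sup>2" t] by (simp add: borel_measurable_integrable)
    moreover have "(\<lambda>x. indicator ?K (x + t) * (norm (G (x + t)))\<^sup>2) = (\<lambda>x. indicator K x * (norm (G (x + t)))\<^sup>2)"
      by (auto simp: fun_eq_iff split: split_indicator)
    ultimately have "integrable (lebesgue_on K) (\<lambda>x. (norm (G (x + t)))\<^sup>2)"
      using Km by (simp add: integrable_restrict_space)
    moreover have "?G \<in> borel_measurable (lebesgue_on K)"
      by (intro measurable_restrict_space1 integral_lebesgue_shift(3) L2loc_measurable G)
    ultimately show "?G \<in> L2 K" by (simp add: L2_def)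
  qed
  ultimately show ?thesis
    using weak_gradient_unique[OF open_UNIV _ G(1) _ G(2), of ?G]
    by (simp add: AE_restrict_space_iff)
qed

locale periodic_cell =
  fixes a b :: "real^'d"
  assumes nondegenerate: "a $ i < b $ i"
begin

text \<open>The whole space is tiled by translates of the half-open cell by the vectors \<open>lattice_vec k\<close>;
  \<open>cell_index x\<close> tells which tile contains \<open>x\<close>, and \<open>to_cell x\<close> is the corresponding point of
  the basic tile.\<close>
definition lattice_vec :: "int^'d \<Rightarrow> real^'d" where
  "lattice_vec k = (\<chi> i. of_int (k $ i) * (b $ i - a $ i))"

definition cell_index :: "real^'d \<Rightarrow> int^'d" where
  "cell_index x = (\<chi> i. \<lfloor>(x $ i - a $ i) / (b $ i - a $ i)\<rfloor>)"

definition to_cell :: "real^'d \<Rightarrow> real^'d" where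
  "to_cell x = x - lattice_vec (cell_index x)"

definition cell :: "(real^'d) set" where
  "cell = {x. \<forall>i. a $ i \<le> x $ i \<and> x $ i < b $ i}"

lemma cell_index_shift: "cell_index (x + lattice_vec k) = cell_index x + k"
proof -
  have "(x $ i + of_int (k $ i) * (b $ i - a $ i) - a $ i) / (b $ i - a $ i)
      = (x $ i - a $ i) / (b $ i - a $ i) + of_int (k $ i)" for i
    using nondegenerate[of i] by (simp add: field_simps)
  then show ?thesis by (simp add: cell_index_def lattice_vec_def vec_eq_iff)
qed

lemma lattice_vec_add: "lattice_vec (k + l) = lattice_vec k + lattice_vec l"
  by (simp add: lattice_vec_def vec_eq_iff algebra_simps)

lemma to_cell_shift: "to_cell (x + lattice_vec k) = to_cell x"
  by (simp add: to_cell_def cell_index_shift lattice_vec_add)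

lemma cell_index_eq_0_iff: "x \<in> cell \<longleftrightarrow> cell_index x = 0"
proof -
  have "\<lfloor>(x $ i - a $ i) / (b $ i - a $ i)\<rfloor> = 0 \<longleftrightarrow> a $ i \<le> x $ i \<and> x $ i < b $ i" for i
    using nondegenerate[of i] by (auto simp: floor_eq_iff field_simps)
  then show ?thesis by (simp add: cell_def cell_index_def vec_eq_iff)
qed

lemma lattice_vec_0 [simp]: "lattice_vec 0 = 0"
  by (simp add: lattice_vec_def vec_eq_iff)

lemma cell_index_minus: "cell_index (x - lattice_vec k) = cell_index x - k"
  using cell_index_shift[of "x - lattice_vec k" k] by simp

lemma to_cell_in_cell: "to_cell x \<in> cell"
  by (simp add: cell_index_eq_0_iff to_cell_def cell_index_minus)

lemma to_cell_id: "x \<in> cell \<Longrightarrow> to_cell x = x"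
  by (simp add: cell_index_eq_0_iff to_cell_def)

lemma box_subset_cell: "box a b \<subseteq> cell"
  by (auto simp: cell_def mem_box_cart less_imp_le)

lemma to_cell_box: "x \<in> box a b \<Longrightarrow> to_cell x = x"
  using box_subset_cell to_cell_id by blast

lemma AE_cell_box: "AE x in lebesgue. x \<in> cell \<longrightarrow> x \<in> box a b"
proof (rule AE_I')
  show "cbox a b - box a b \<in> null_sets lebesgue"
    using negligible_frontier_interval by (simp add: negligible_iff_null_sets)
  show "{x \<in> space lebesgue. \<not> (x \<in> cell \<longrightarrow> x \<in> box a b)} \<subseteq> cbox a b - box a b"
    by (auto simp: cell_def mem_box_cart less_imp_le)
qed

text \<open>The exceptional set is a countable union of lattice translates of null sets, the boundary of the
  open box included.\<close>
lemma AE_to_cell: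
  assumes "AE x in lebesgue_on (box a b). Q x"
  shows "AE x in lebesgue. to_cell x \<in> box a b \<and> Q (to_cell x)"
proof -
  have "AE x in lebesgue. x \<in> box a b \<longrightarrow> Q x"
    using assms by (simp add: AE_restrict_space_iff)
  with AE_cell_box have "AE x in lebesgue. x \<in> cell \<longrightarrow> x \<in> box a b \<and> Q x"
    by eventually_elim blast
  then have "AE x in lebesgue. \<forall>k. x + - lattice_vec k \<in> cell \<longrightarrow> x + - lattice_vec k \<in> box a b \<and> Q (x + - lattice_vec k)"
    unfolding AE_all_countable by (intro allI AE_lebesgue_shift)
  then show ?thesis
  proof eventually_elim
    case (elim x)
    then have "x - lattice_vec (cell_index x) \<in> cell \<longrightarrow> x - lattice_vec (cell_index x) \<in> box a b \<and> Q (x - lattice_vec (cell_index x))"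
      by simp
    then show ?case using to_cell_in_cell[of x] by (simp add: to_cell_def)
  qed
qed

text \<open>The value 0 on the lattice translates of the faces (a null set) has a technical reason: the
  extension then depends only on the values of \<open>f\<close> in the open box, which is where measurability is
  known.\<close>
definition periodic_ext :: "(real^'d \<Rightarrow> 'b::zero) \<Rightarrow> real^'d \<Rightarrow> 'b" where
  "periodic_ext f x = (if to_cell x \<in> box a b then f (to_cell x) else 0)"

lemma periodic_ext_shift: "periodic_ext f (x + lattice_vec k) = periodic_ext f x"
  by (simp add: periodic_ext_def to_cell_shift)

lemma periodic_ext_box: "x \<in> box a b \<Longrightarrow> periodic_ext f x = f x"
  by (simp add: periodic_ext_def to_cell_box)

lemma periodic_ext_diff: "periodic_ext (f - g) = periodic_ext f - periodic_ext (g :: real^'d \<Rightarrow> 'b::group_add)"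
  by (auto simp: periodic_ext_def fun_eq_iff)

lemma finite_cells:
  assumes "compact K"
  shows "\<exists>J. finite J \<and> cell_index ` K \<subseteq> J"
proof -
  obtain p q where K: "K \<subseteq> cbox p q"
    using bounded_subset_cbox_symmetric[OF compact_imp_bounded[OF assms]] by blast
  define L where "L i = {cell_index p $ i .. cell_index q $ i}" for i
  have "finite ((\<lambda>g. \<chi> i. g i) ` (\<Pi>\<^sub>E i\<in>(UNIV::'d set). L i))"
    by (intro finite_imageI finite_PiE) (auto simp: L_def)
  moreover have "cell_index ` K \<subseteq> (\<lambda>g. \<chi> i. g i) ` (\<Pi>\<^sub>E i\<in>(UNIV::'d set). L i)"
  proof
    fix k assume "k \<in> cell_index ` K"
    then obtain x where k: "k = cell_index x" and x: "x \<in> cbox p q" using K by blast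
    have "cell_index x $ i \<in> L i" for i
      using x nondegenerate[of i]
      by (auto simp: L_def cell_index_def mem_box_cart intro!: floor_mono divide_right_mono)
    then show "k \<in> (\<lambda>g. \<chi> i. g i) ` (\<Pi>\<^sub>E i\<in>(UNIV::'d set). L i)"
      unfolding k by (intro image_eqI[of _ _ "\<lambda>i. cell_index x $ i"]) (auto simp: vec_eq_iff)
  qed
  ultimately show ?thesis by blast
qed

lemma sum_shifts:
  fixes h :: "real^'d \<Rightarrow> 'b::comm_monoid_add"
  assumes "finite J" "cell_index x \<in> J" "\<And>y. y \<notin> cell \<Longrightarrow> h y = 0"
  shows "(\<Sum>k\<in>J. h (x - lattice_vec k)) = h (to_cell x)"
proof -
  have "(\<Sum>k\<in>J. h (x - lattice_vec k)) = (\<Sum>k\<in>J. if k = cell_index x then h (to_cell x) else 0)"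
  proof (rule sum.cong)
    fix k
    show "h (x - lattice_vec k) = (if k = cell_index x then h (to_cell x) else 0)"
    proof (cases "k = cell_index x")
      case False
      then have "x - lattice_vec k \<notin> cell" by (simp add: cell_index_eq_0_iff cell_index_minus)
      then show ?thesis using False assms(3) by simp
    qed (simp add: to_cell_def)
  qed simp
  then show ?thesis using assms(1,2) by simp
qed

text \<open>A compact set meets finitely many tiles. On it the extension is a finite sum of disjointly
  supported translates, each with the same norm as \<open>f\<close>; their number is the constant \<open>N\<close>.\<close>
lemma periodic_ext_L2:
  assumes K: "compact K"
  shows "\<exists>N. \<forall>f\<in>L2 (box a b). periodic_ext (f :: real^'d \<Rightarrow> 'b::euclidean_space) \<in> L2 K \<and>
    L2_inner K (periodic_ext f) (periodic_ext f) \<le> N * L2_inner (box a b) f f"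
proof -
  obtain J where J: "finite J" "cell_index ` K \<subseteq> J" using finite_cells[OF K] by blast
  have Km: "K \<in> sets lebesgue" using lmeasurable_compact[OF K] by (rule fmeasurableD)
  have "periodic_ext f \<in> L2 K \<and> L2_inner K (periodic_ext f) (periodic_ext f) \<le> real (card J) * L2_inner (box a b) f f"
    if f: "f \<in> L2 (box a b)" for f :: "real^'d \<Rightarrow> 'b"
  proof -
    define f0 where "f0 x = (if x \<in> box a b then f x else 0)" for x
    have m: "f0 \<in> borel_measurable lebesgue"
      unfolding f0_def using L2_measurable[OF f] by (intro borel_measurable_if_I) auto
    have ind: "(\<lambda>x. indicator (box a b) x *\<^sub>R (norm (f x))\<^sup>2) = (\<lambda>x. (norm (f0 x))\<^sup>2)"
      by (auto simp: f0_def fun_eq_iff split: split_indicator)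
    have i0: "integrable lebesgue (\<lambda>x. (norm (f0 x))\<^sup>2)"
      using L2_integrable_norm_sq[OF f] by (simp add: integrable_restrict_space flip: ind)
    have e0: "(\<integral>x. (norm (f0 x))\<^sup>2 \<partial>lebesgue) = L2_inner (box a b) f f"
      by (simp add: L2_inner_self integral_restrict_space flip: ind)
    have m2: "(\<lambda>x. (norm (f0 x))\<^sup>2) \<in> borel_measurable lebesgue" using m by measurable
    have off: "f0 y = 0" if "y \<notin> cell" for y
      using that box_subset_cell by (auto simp: f0_def)
    have shift: "(\<lambda>x. f0 (x - lattice_vec k)) \<in> borel_measurable lebesgue"
      "integrable lebesgue (\<lambda>x. (norm (f0 (x - lattice_vec k)))\<^sup>2)"
      "(\<integral>x. (norm (f0 (x - lattice_vec k)))\<^sup>2 \<partial>lebesgue) = L2_inner (box a b) f f" for k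
      using integral_lebesgue_shift(3)[OF m, of "- lattice_vec k"] integral_lebesgue_shift(1,2)[OF m2, of "- lattice_vec k"] i0 e0
      by auto
    have s1: "(\<Sum>k\<in>J. f0 (x - lattice_vec k)) = periodic_ext f x" if "x \<in> K" for x
      using sum_shifts[of J x f0] J that off by (auto simp: periodic_ext_def f0_def)
    have s2: "(\<Sum>k\<in>J. (norm (f0 (x - lattice_vec k)))\<^sup>2) = (norm (periodic_ext f x))\<^sup>2" if "x \<in> K" for x
      using sum_shifts[of J x "\<lambda>y. (norm (f0 y))\<^sup>2"] J that off by (auto simp: periodic_ext_def f0_def)
    have "(\<lambda>x. \<Sum>k\<in>J. f0 (x - lattice_vec k)) \<in> borel_measurable (lebesgue_on K)"
      by (intro borel_measurable_sum measurable_restrict_space1 shift)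
    then have pm: "periodic_ext f \<in> borel_measurable (lebesgue_on K)"
      by (subst measurable_cong[where g = "\<lambda>x. \<Sum>k\<in>J. f0 (x - lattice_vec k)"]) (auto simp: s1 space_restrict_space)
    have si: "integrable lebesgue (\<lambda>x. \<Sum>k\<in>J. (norm (f0 (x - lattice_vec k)))\<^sup>2)"
      by (intro Bochner_Integration.integrable_sum shift)
    have eqK: "(\<lambda>x. indicator K x *\<^sub>R (norm (periodic_ext f x))\<^sup>2) = (\<lambda>x. indicator K x *\<^sub>R (\<Sum>k\<in>J. (norm (f0 (x - lattice_vec k)))\<^sup>2))"
      using s2 by (auto simp: fun_eq_iff split: split_indicator)
    have iK: "integrable lebesgue (\<lambda>x. indicator K x *\<^sub>R (norm (periodic_ext f x))\<^sup>2)"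
      unfolding eqK by (intro integrable_mult_indicator si Km)
    have "periodic_ext f \<in> L2 K"
      using pm iK Km by (simp add: L2_def integrable_restrict_space)
    moreover have "L2_inner K (periodic_ext f) (periodic_ext f) = (\<integral>x. indicator K x *\<^sub>R (norm (periodic_ext f x))\<^sup>2 \<partial>lebesgue)"
      using Km by (simp add: L2_inner_self integral_restrict_space)
    moreover have "\<dots> \<le> (\<integral>x. (\<Sum>k\<in>J. (norm (f0 (x - lattice_vec k)))\<^sup>2) \<partial>lebesgue)"
      using iK si unfolding eqK by (rule integral_mono) (auto split: split_indicator intro!: sum_nonneg)
    moreover have "\<dots> = real (card J) * L2_inner (box a b) f f"
      by (subst Bochner_Integration.integral_sum) (auto intro: shift simp: shift(3))
    ultimately show ?thesis by simp
  qed
  then show ?thesis by blast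
qed

lemma periodic_ext_L2loc: "f \<in> L2 (box a b) \<Longrightarrow> periodic_ext (f :: real^'d \<Rightarrow> 'b::euclidean_space) \<in> L2loc UNIV"
  using periodic_ext_L2 by (fastforce simp: L2loc_def)

text \<open>The periods of \<open>v\<close> form an additive group, and the lattice is generated by the edges of the box.\<close>
lemma box_periodic_lattice_vec:
  assumes "box_periodic a b v"
  shows "v (x + lattice_vec k) = v x"
proof -
  define T where "T = {z. \<forall>x. v (x + z) = v x}"
  have T_add: "y + z \<in> T" if "y \<in> T" "z \<in> T" for y z
    using that by (simp add: T_def add.assoc[symmetric])
  have T_minus: "- z \<in> T" if "z \<in> T" for z
  proof -
    have "v (x + - z) = v x" for x
      using that[unfolded T_def, simplified, rule_format, of "x - z"] by simp
    then show ?thesis by (simp add: T_def)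
  qed
  have T_axis: "axis i (of_int n * (b $ i - a $ i)) \<in> T" for i n
  proof -
    let ?e = "axis i (b $ i - a $ i)"
    have e: "?e \<in> T" using assms by (simp add: T_def box_periodic_def)
    have nat: "axis i (real m * (b $ i - a $ i)) \<in> T" for m
    proof (induction m)
      case 0
      have "axis i (0 :: real) = 0" by (simp add: axis_def vec_eq_iff)
      then have "axis i (real 0 * (b $ i - a $ i)) = 0" by simp
      then show ?case unfolding T_def by (simp only: add_0_right mem_Collect_eq simp_thms)
    next
      case (Suc m)
      have "axis i (real (Suc m) * (b $ i - a $ i)) = axis i (real m * (b $ i - a $ i)) + ?e"
        by (simp add: axis_def vec_eq_iff algebra_simps)
      then show ?case using T_add[OF Suc e] by simp
    qed
    show ?thesis
    proof (cases "n \<ge> 0")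
      case True
      then show ?thesis using nat[of "nat n"] by simp
    next
      case False
      have "axis i (of_int n * (b $ i - a $ i)) = - axis i (real (nat (- n)) * (b $ i - a $ i))"
        using False by (simp add: axis_def vec_eq_iff)
      then show ?thesis using T_minus[OF nat[of "nat (- n)"]] by simp
    qed
  qed
  have "(\<Sum>i\<in>I. axis i (of_int (k $ i) * (b $ i - a $ i))) \<in> T" if "finite I" for I
    using that
  proof (induction I)
    case empty
    show ?case by (simp add: T_def)
  next
    case (insert i I)
    then show ?case using T_add[OF T_axis] by simp
  qed
  moreover have "lattice_vec k = (\<Sum>i\<in>UNIV. axis i (of_int (k $ i) * (b $ i - a $ i)))"
    by (simp add: lattice_vec_def axis_def vec_eq_iff sum.delta)
  ultimately show ?thesis by (simp add: T_def)
qed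

lemma has_weak_gradient_box:
  assumes "has_weak_gradient UNIV v G"
  shows "has_weak_gradient (box a b) v G"
  unfolding has_weak_gradient_def
proof (intro ballI allI)
  fix \<eta> i assume \<eta>: "\<eta> \<in> test_functions (box a b)"
  then have \<eta>': "\<eta> \<in> test_functions UNIV" by (auto simp: test_functions_def)
  show "(\<integral>x. v x * partial_deriv i \<eta> x \<partial>(lebesgue_on (box a b))) = - (\<integral>x. G x $ i * \<eta> x \<partial>(lebesgue_on (box a b)))"
    using assms \<eta>' unfolding weak_gradient_integrals(5,6)[OF open_box \<eta>]
    by (simp add: has_weak_gradient_alt)
qed

text \<open>The definition of a periodic \<open>H\<^sup>1\<close> function provides some periodic extension \<open>v\<close> with some local
  weak gradient \<open>G\<close>. Since \<open>v\<close> is periodic, so is \<open>G\<close> almost everywhere; on the box it is the weak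
  gradient of \<open>u\<close>. Both are thus the periodic extensions of their restrictions to the box.\<close>
lemma weak_gradient_periodic_ext:
  assumes u: "u \<in> H1_periodic a b"
  shows "has_weak_gradient UNIV (periodic_ext u) (periodic_ext (weak_grad (box a b) u))"
proof -
  let ?g = "weak_grad (box a b) u"
  from u obtain v where v: "v \<in> H1loc UNIV" "box_periodic a b v"
      "AE x in lebesgue_on (box a b). v x = u x" and uH: "u \<in> H1 (box a b)"
    by (auto simp: H1_periodic_def)
  from v(1) obtain G where vL: "v \<in> L2loc UNIV" and G: "G \<in> L2loc UNIV" "has_weak_gradient UNIV v G"
    by (auto simp: H1loc_def)
  note g = weak_grad[OF uH]
  have uL: "u \<in> L2 (box a b)" using uH by (simp add: H1_def)
  have bm: "box a b \<in> sets lebesgue" by simp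
  have locbox: "f \<in> L2loc (box a b)" if "f \<in> L2loc UNIV" for f :: "real^'d \<Rightarrow> real^'d"
    using that by (auto simp: L2loc_def)
  have "has_weak_gradient (box a b) u G"
  proof (rule has_weak_gradient_cong_AE[OF bm _ _ _ _ v(3) _ has_weak_gradient_box[OF G(2)]])
    show "v \<in> borel_measurable (lebesgue_on (box a b))" "G \<in> borel_measurable (lebesgue_on (box a b))"
        "G \<in> borel_measurable (lebesgue_on (box a b))"
      using vL G by (auto intro: measurable_restrict_space1 L2loc_measurable)
  qed (use L2_measurable[OF uL] in auto)
  then have "AE x in lebesgue_on (box a b). G x = ?g x"
    using g L2_subset_L2loc[OF bm] by (intro weak_gradient_unique[OF open_box locbox[OF G(1)]]) auto
  from AE_to_cell[OF this] AE_to_cell[OF v(3)]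
  have on_cell: "AE x in lebesgue. G (to_cell x) = periodic_ext ?g x \<and> v (to_cell x) = periodic_ext u x"
    by eventually_elim (simp add: periodic_ext_def)
  have "AE x in lebesgue. \<forall>k. G (x + - lattice_vec k) = G x"
    unfolding AE_all_countable
  proof
    fix k
    have "v (x + - lattice_vec k) = v x" for x
      using box_periodic_lattice_vec[OF v(2), of "x - lattice_vec k" k] by simp
    then show "AE x in lebesgue. G (x + - lattice_vec k) = G x"
      by (intro weak_gradient_shift_invariant[OF vL _ G])
  qed
  with on_cell have ae: "AE x in lebesgue. G x = periodic_ext ?g x \<and> v x = periodic_ext u x"
  proof eventually_elim
    case (elim x)
    have "v (to_cell x) = v x"
      using box_periodic_lattice_vec[OF v(2), of "to_cell x" "cell_index x"] by (simp add: to_cell_def)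
    moreover have "G (to_cell x) = G x"
      using elim(2) by (simp add: to_cell_def)
    ultimately show ?case using elim(1) by simp
  qed
  show ?thesis
  proof (rule has_weak_gradient_cong_AE[OF _ _ _ _ _ _ _ G(2)])
    show "AE x in lebesgue_on UNIV. v x = periodic_ext u x" "AE x in lebesgue_on UNIV. G x = periodic_ext ?g x"
      using ae by (simp_all add: AE_restrict_space_iff)
  qed (use vL G uL g(1) in \<open>auto simp: lebesgue_on_UNIV_eq intro: L2loc_measurable periodic_ext_L2loc\<close>)
qed

text \<open>Conversely, the periodic extension of \<open>u\<close> is a witness of periodicity, and restricting the test
  functions to the box shows that \<open>g\<close> is the weak gradient there.\<close>
lemma H1_periodicI:
  assumes u: "u \<in> L2 (box a b)" and g: "g \<in> L2 (box a b)"
    and wg: "has_weak_gradient UNIV (periodic_ext u) (periodic_ext g)"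
  shows "u \<in> H1_periodic a b" "has_weak_gradient (box a b) u g"
proof -
  show wgb: "has_weak_gradient (box a b) u g"
    unfolding has_weak_gradient_def
  proof (intro ballI allI)
    fix \<eta> i assume \<eta>: "\<eta> \<in> test_functions (box a b)"
    have "(\<integral>x. u x * partial_deriv i \<eta> x \<partial>(lebesgue_on (box a b))) = (\<integral>x. periodic_ext u x * partial_deriv i \<eta> x \<partial>(lebesgue_on (box a b)))"
      by (intro Bochner_Integration.integral_cong) (auto simp: space_restrict_space periodic_ext_box)
    also have "\<dots> = - (\<integral>x. periodic_ext g x $ i * \<eta> x \<partial>(lebesgue_on (box a b)))"
      using has_weak_gradient_box[OF wg] \<eta> by (simp add: has_weak_gradient_def)
    also have "(\<integral>x. periodic_ext g x $ i * \<eta> x \<partial>(lebesgue_on (box a b))) = (\<integral>x. g x $ i * \<eta> x \<partial>(lebesgue_on (box a b)))"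
      by (intro Bochner_Integration.integral_cong) (auto simp: space_restrict_space periodic_ext_box)
    finally show "(\<integral>x. u x * partial_deriv i \<eta> x \<partial>(lebesgue_on (box a b))) = - (\<integral>x. g x $ i * \<eta> x \<partial>(lebesgue_on (box a b)))" .
  qed
  have "box_periodic a b (periodic_ext u)"
  proof -
    have "periodic_ext u (x + axis i (b $ i - a $ i)) = periodic_ext u x" for x i
    proof -
      have "axis i (b $ i - a $ i) = lattice_vec (axis i 1)" by (simp add: lattice_vec_def axis_def vec_eq_iff)
      then show ?thesis by (simp add: periodic_ext_shift)
    qed
    then show ?thesis by (simp add: box_periodic_def)
  qed
  moreover have "periodic_ext u \<in> H1loc UNIV"
    using wg periodic_ext_L2loc[OF u] periodic_ext_L2loc[OF g] by (auto simp: H1loc_def)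
  moreover have "AE x in lebesgue_on (box a b). periodic_ext u x = u x"
    by (intro AE_I2) (auto simp: space_restrict_space periodic_ext_box)
  moreover have "u \<in> H1 (box a b)" using u g wgb by (auto simp: H1_def)
  ultimately show "u \<in> H1_periodic a b" by (auto simp: H1_periodic_def)
qed

end


section \<open>The linear system on periodic mean-free functions\<close>

lemma L2_inner_cong_AE:
  assumes "u \<in> L2 S" "u' \<in> L2 S" "v \<in> L2 S" "v' \<in> L2 S"
    "AE x in lebesgue_on S. u x = u' x" "AE x in lebesgue_on S. v x = v' x"
  shows "L2_inner S u v = L2_inner S u' v'"
  unfolding L2_inner_def
  using assms(5,6) L2_inner_integrable[OF assms(1,3)] L2_inner_integrable[OF assms(2,4)]
  by (intro integral_cong_AE) auto

lemma L2_inner_self_eq_0: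
  assumes "u \<in> L2 S" "L2_inner S u u = 0"
  shows "AE x in lebesgue_on S. u x = 0"
proof -
  have "AE x in lebesgue_on S. (norm (u x))\<^sup>2 = 0"
    using assms(2) integral_nonneg_eq_0_iff_AE[OF L2_integrable_norm_sq[OF assms(1)]]
    by (simp add: L2_inner_self)
  then show ?thesis by simp
qed

lemma L2_mult_Linf:
  assumes h: "h \<in> borel_measurable (lebesgue_on S)" "AE x in lebesgue_on S. \<bar>h x\<bar> \<le> C" and u: "u \<in> L2 S"
  shows "(\<lambda>x. h x * u x) \<in> L2 S" "L2_inner S (\<lambda>x. h x * u x) (\<lambda>x. h x * u x) \<le> C\<^sup>2 * L2_inner S u u"
proof -
  note [measurable] = h(1) L2_measurable[OF u]
  show hu: "(\<lambda>x. h x * u x) \<in> L2 S"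
  proof (rule L2_bound[OF u])
    show "AE x in lebesgue_on S. norm (h x * u x) \<le> C * norm (u x)"
      using h(2) by eventually_elim (simp add: abs_mult mult_right_mono)
  qed measurable
  have "L2_inner S (\<lambda>x. h x * u x) (\<lambda>x. h x * u x) \<le> (\<integral>x. C\<^sup>2 * (u x \<bullet> u x) \<partial>(lebesgue_on S))"
    unfolding L2_inner_def
  proof (rule integral_mono_AE)
    show "AE x in lebesgue_on S. (h x * u x) \<bullet> (h x * u x) \<le> C\<^sup>2 * (u x \<bullet> u x)"
      using h(2)
    proof eventually_elim
      case (elim x)
      then have "\<bar>h x\<bar>\<^sup>2 \<le> C\<^sup>2" by (intro power_mono) auto
      then have "(h x)\<^sup>2 * (u x)\<^sup>2 \<le> C\<^sup>2 * (u x)\<^sup>2" by (intro mult_right_mono) auto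
      then show ?case by (simp add: power2_eq_square mult_ac)
    qed
  qed (use L2_inner_integrable[OF hu hu] L2_inner_integrable[OF u u] in auto)
  then show "L2_inner S (\<lambda>x. h x * u x) (\<lambda>x. h x * u x) \<le> C\<^sup>2 * L2_inner S u u"
    by (simp add: L2_inner_def)
qed

context periodic_cell
begin

abbreviation "\<Omega> \<equiv> box a b"
abbreviation "grad \<equiv> weak_grad \<Omega>"

lemma one_L2: "(\<lambda>x. 1 :: real) \<in> L2 \<Omega>"
  by (rule L2_mono[OF continuous_L2[OF compact_cbox continuous_on_const] box_subset_cbox]) auto

lemma L2_inner_one: "L2_inner \<Omega> u (\<lambda>x. 1) = (\<integral>x. u x \<partial>(lebesgue_on \<Omega>))"
  by (simp add: L2_inner_def)

lemma H1_periodicD: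
  assumes "u \<in> H1_periodic a b"
  shows "u \<in> L2 \<Omega>" "grad u \<in> L2 \<Omega>"
  using assms weak_grad(1) by (auto simp: H1_periodic_def H1_def)

text \<open>The extensions add up on the whole space, and uniqueness of weak gradients identifies the chosen
  gradient of the sum; the same holds for multiples.\<close>
lemma H1_periodic_add:
  assumes u: "u \<in> H1_periodic a b" and v: "v \<in> H1_periodic a b"
  shows "u + v \<in> H1_periodic a b" "AE x in lebesgue_on \<Omega>. grad (u + v) x = (grad u + grad v) x"
proof -
  note U = H1_periodicD[OF u] and V = H1_periodicD[OF v]
  have sum: "u + v \<in> L2 \<Omega>" "grad u + grad v \<in> L2 \<Omega>" using U V by simp_all
  have p: "periodic_ext (f + g) = periodic_ext f + periodic_ext g" for f g :: "real^'d \<Rightarrow> 'b::monoid_add"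
    by (auto simp: periodic_ext_def fun_eq_iff)
  have "has_weak_gradient UNIV (periodic_ext (u + v)) (periodic_ext (grad u + grad v))"
    unfolding p by (intro has_weak_gradient_add periodic_ext_L2loc weak_gradient_periodic_ext U V u v open_UNIV)
  from H1_periodicI[OF sum this] show "u + v \<in> H1_periodic a b"
    "AE x in lebesgue_on \<Omega>. grad (u + v) x = (grad u + grad v) x"
    using sum weak_grad_AE_eq[OF open_box] by blast+
qed

lemma H1_periodic_scale:
  assumes u: "u \<in> H1_periodic a b"
  shows "c *\<^sub>R u \<in> H1_periodic a b" "AE x in lebesgue_on \<Omega>. grad (c *\<^sub>R u) x = (c *\<^sub>R grad u) x"
proof -
  note U = H1_periodicD[OF u]
  have s: "c *\<^sub>R u \<in> L2 \<Omega>" "c *\<^sub>R grad u \<in> L2 \<Omega>" using U by simp_all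
  have p: "periodic_ext (c *\<^sub>R f) = c *\<^sub>R periodic_ext f" for f :: "real^'d \<Rightarrow> 'b::real_vector"
    by (auto simp: periodic_ext_def fun_eq_iff)
  have "has_weak_gradient UNIV (periodic_ext (c *\<^sub>R u)) (periodic_ext (c *\<^sub>R grad u))"
    unfolding p by (intro has_weak_gradient_scale weak_gradient_periodic_ext u)
  from H1_periodicI[OF s this] show "c *\<^sub>R u \<in> H1_periodic a b"
    "AE x in lebesgue_on \<Omega>. grad (c *\<^sub>R u) x = (c *\<^sub>R grad u) x"
    using s weak_grad_AE_eq[OF open_box] by blast+
qed

lemma H_perD:
  assumes "u \<in> H_per a b"
  shows "u \<in> H1_periodic a b" "u \<in> L2 \<Omega>" "grad u \<in> L2 \<Omega>" "L2_inner \<Omega> u (\<lambda>x. 1) = 0"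
  using assms H1_periodicD by (auto simp: H_per_def L2_inner_one)

lemma H_perI: "\<lbrakk>u \<in> H1_periodic a b; L2_inner \<Omega> u (\<lambda>x. 1) = 0\<rbrakk> \<Longrightarrow> u \<in> H_per a b"
  by (simp add: H_per_def L2_inner_one)

lemma subspace_H_per: "subspace (H_per a b)"
proof (rule subspaceI)
  have "periodic_ext 0 = (0 :: real^'d \<Rightarrow> real)" "periodic_ext 0 = (0 :: real^'d \<Rightarrow> real^'d)"
    by (auto simp: periodic_ext_def fun_eq_iff)
  moreover have "has_weak_gradient UNIV (0 :: real^'d \<Rightarrow> real) 0" by (simp add: has_weak_gradient_def)
  ultimately have "(0 :: real^'d \<Rightarrow> real) \<in> H1_periodic a b"
    by (intro H1_periodicI(1)[OF L2.subspace_closed(1) L2.subspace_closed(1)]) simp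
  then show "0 \<in> H_per a b" by (simp add: H_perI L2_inner_def)
  fix u v :: "real^'d \<Rightarrow> real" and c :: real
  assume u: "u \<in> H_per a b"
  note U = H_perD[OF u]
  show "c *\<^sub>R u \<in> H_per a b"
    using U H1_periodic_scale(1)[OF U(1)] by (intro H_perI) (simp_all add: L2.scale_left one_L2)
  assume v: "v \<in> H_per a b"
  note V = H_perD[OF v]
  show "u + v \<in> H_per a b"
    using U V H1_periodic_add(1)[OF U(1) V(1)] by (intro H_perI) (simp_all add: L2.add_left one_L2)
qed

definition dirichlet :: "(real^'d \<Rightarrow> real) \<Rightarrow> (real^'d \<Rightarrow> real) \<Rightarrow> real" where
  "dirichlet u v = L2_inner \<Omega> (grad u) (grad v)"

lemma mass_form: "semi_inner_product (H_per a b) (L2_inner \<Omega>)"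
  by unfold_locales (auto simp: L2.bilin L2.nonneg L2.sym H_perD intro: subspace_H_per)

lemma dirichlet_form: "semi_inner_product (H_per a b) dirichlet"
proof -
  have sym: "dirichlet x y = dirichlet y x" if "x \<in> H_per a b" "y \<in> H_per a b" for x y
    using that by (simp add: dirichlet_def L2.sym H_perD)
  have add: "dirichlet (x + y) z = dirichlet x z + dirichlet y z"
    if "x \<in> H_per a b" "y \<in> H_per a b" "z \<in> H_per a b" for x y z
  proof -
    note X = H_perD[OF that(1)] and Y = H_perD[OF that(2)] and Z = H_perD[OF that(3)]
    note XY = H1_periodic_add[OF X(1) Y(1)]
    have "dirichlet (x + y) z = L2_inner \<Omega> (grad x + grad y) (grad z)"
      unfolding dirichlet_def using X Y Z XY H1_periodicD[OF XY(1)]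
      by (intro L2_inner_cong_AE) auto
    then show ?thesis using X Y Z by (simp add: dirichlet_def L2.add_left)
  qed
  have scale: "dirichlet (c *\<^sub>R x) z = c * dirichlet x z" if "x \<in> H_per a b" "z \<in> H_per a b" for x z c
  proof -
    note X = H_perD[OF that(1)] and Z = H_perD[OF that(2)]
    note cX = H1_periodic_scale[OF X(1), of c]
    have "dirichlet (c *\<^sub>R x) z = L2_inner \<Omega> (c *\<^sub>R grad x) (grad z)"
      unfolding dirichlet_def using X Z cX H1_periodicD[OF cX(1)]
      by (intro L2_inner_cong_AE) auto
    then show ?thesis using X Z by (simp add: dirichlet_def L2.scale_left)
  qed
  show ?thesis
  proof unfold_locales
    show "dirichlet z (x + y) = dirichlet z x + dirichlet z y"
      if "x \<in> H_per a b" "y \<in> H_per a b" "z \<in> H_per a b" for x y z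
      using add[OF that] that subspace_add[OF subspace_H_per that(1,2)] by (simp add: sym)
    show "dirichlet z (c *\<^sub>R x) = c * dirichlet z x" if "x \<in> H_per a b" "z \<in> H_per a b" for x z c
      using scale[OF that] that subspace_scale[OF subspace_H_per that(1)] by (simp add: sym)
    show "0 \<le> dirichlet x x" if "x \<in> H_per a b" for x
      using that by (simp add: dirichlet_def L2.nonneg H_perD)
  qed (use add scale sym subspace_H_per in auto)
qed

text \<open>A Cauchy sequence in the \<open>H\<^sup>1\<close> norm has \<open>L\<^sup>2\<close> limits \<open>u\<close> of the functions and \<open>g\<close> of the
  gradients. The periodic extensions converge in \<open>L\<^sup>2\<close> on compact sets, so the weak gradient relation
  between them passes to the limit, and \<open>u\<close> is periodic with gradient \<open>g\<close>. The mean is the inner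
  product with the constant 1, hence continuous.\<close>
lemma energy_complete: "complete_semi_inner_product (H_per a b) (\<lambda>x y. L2_inner \<Omega> x y + dirichlet x y)"
proof -
  interpret m: semi_inner_product "H_per a b" "L2_inner \<Omega>" by (rule mass_form)
  interpret d: semi_inner_product "H_per a b" dirichlet by (rule dirichlet_form)
  show ?thesis
  proof unfold_locales
    fix X :: "nat \<Rightarrow> real^'d \<Rightarrow> real"
    assume X: "\<And>n. X n \<in> H_per a b"
      and cau: "\<And>e. e > 0 \<Longrightarrow> \<exists>N. \<forall>m\<ge>N. \<forall>n\<ge>N.
        L2_inner \<Omega> (X m - X n) (X m - X n) + dirichlet (X m - X n) (X m - X n) < e"
    note XD = H_perD[OF X]
    have diff: "X m - X n \<in> H_per a b" for m n using X by simp
    have grad_diff: "AE x in lebesgue_on \<Omega>. grad (v - u) x = (grad v - grad u) x"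
      if u: "u \<in> H1_periodic a b" and v: "v \<in> H1_periodic a b" for u v
    proof -
      have "AE x in lebesgue_on \<Omega>. grad (v + (-1) *\<^sub>R u) x = (grad v + grad ((-1) *\<^sub>R u)) x"
        by (intro H1_periodic_add H1_periodic_scale u v)
      moreover have "AE x in lebesgue_on \<Omega>. grad ((-1) *\<^sub>R u) x = ((-1) *\<^sub>R grad u) x"
        by (intro H1_periodic_scale u)
      ultimately show ?thesis by eventually_elim simp
    qed
    have dd: "dirichlet (X m - X n) (X m - X n) = L2_inner \<Omega> (grad (X m) - grad (X n)) (grad (X m) - grad (X n))" for m n
      unfolding dirichlet_def using grad_diff[OF XD(1) XD(1)] XD H_perD[OF diff]
      by (intro L2_inner_cong_AE) auto
    have "\<exists>u\<in>L2 \<Omega>. (\<lambda>n. L2_inner \<Omega> (X n - u) (X n - u)) \<longlonglongrightarrow> 0"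
    proof (rule L2.complete)
      fix e :: real assume "e > 0"
      from cau[OF this] show "\<exists>N. \<forall>m\<ge>N. \<forall>n\<ge>N. L2_inner \<Omega> (X m - X n) (X m - X n) < e"
        using d.nonneg[OF diff] by (smt (verit))
    qed (rule XD)
    then obtain u where u: "u \<in> L2 \<Omega>" and lim_u: "(\<lambda>n. L2_inner \<Omega> (X n - u) (X n - u)) \<longlonglongrightarrow> 0" by blast
    have "\<exists>g\<in>L2 \<Omega>. (\<lambda>n. L2_inner \<Omega> (grad (X n) - g) (grad (X n) - g)) \<longlonglongrightarrow> 0"
    proof (rule L2.complete)
      fix e :: real assume "e > 0"
      from cau[OF this] show "\<exists>N. \<forall>m\<ge>N. \<forall>n\<ge>N. L2_inner \<Omega> (grad (X m) - grad (X n)) (grad (X m) - grad (X n)) < e"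
        using m.nonneg[OF diff] unfolding dd by (smt (verit))
    qed (rule XD)
    then obtain g where g: "g \<in> L2 \<Omega>" and lim_g: "(\<lambda>n. L2_inner \<Omega> (grad (X n) - g) (grad (X n) - g)) \<longlonglongrightarrow> 0" by blast
    have lim_periodic_ext: "(\<lambda>n. L2_inner K (periodic_ext (Y n) - periodic_ext y) (periodic_ext (Y n) - periodic_ext y)) \<longlonglongrightarrow> 0"
      if Y: "\<And>n. Y n \<in> L2 \<Omega>" "y \<in> L2 \<Omega>" and lim: "(\<lambda>n. L2_inner \<Omega> (Y n - y) (Y n - y)) \<longlonglongrightarrow> 0" and K: "compact K"
      for Y :: "nat \<Rightarrow> real^'d \<Rightarrow> 'c::euclidean_space" and y K
    proof -
      obtain N where N: "\<And>f :: real^'d \<Rightarrow> 'c. f \<in> L2 \<Omega> \<Longrightarrow> periodic_ext f \<in> L2 K \<and> L2_inner K (periodic_ext f) (periodic_ext f) \<le> N * L2_inner \<Omega> f f"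
        using periodic_ext_L2[OF K] by blast
      have Yd: "Y n - y \<in> L2 \<Omega>" for n using Y by simp
      show ?thesis
      proof (rule tendsto_sandwich[OF _ _ tendsto_const])
        show "(\<lambda>n. N * L2_inner \<Omega> (Y n - y) (Y n - y)) \<longlonglongrightarrow> 0"
          using tendsto_mult_left[OF lim, of N] by simp
        show "\<forall>\<^sub>F n in sequentially. 0 \<le> L2_inner K (periodic_ext (Y n) - periodic_ext y) (periodic_ext (Y n) - periodic_ext y)"
          using N[OF Yd] by (intro always_eventually allI) (auto simp: periodic_ext_diff[symmetric] intro!: L2.nonneg)
        show "\<forall>\<^sub>F n in sequentially. L2_inner K (periodic_ext (Y n) - periodic_ext y) (periodic_ext (Y n) - periodic_ext y) \<le> N * L2_inner \<Omega> (Y n - y) (Y n - y)"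
          using N[OF Yd] by (intro always_eventually allI) (auto simp: periodic_ext_diff[symmetric])
      qed
    qed
    have wg: "has_weak_gradient UNIV (periodic_ext u) (periodic_ext g)"
    proof (rule has_weak_gradient_limit[OF open_UNIV])
      show "has_weak_gradient UNIV (periodic_ext (X n)) (periodic_ext (grad (X n)))" for n
        by (rule weak_gradient_periodic_ext[OF XD(1)])
    qed (auto intro!: periodic_ext_L2loc lim_periodic_ext XD u g lim_u lim_g)
    note periodic = H1_periodicI[OF u g wg]
    have grad_u: "AE x in lebesgue_on \<Omega>. grad u x = g x"
      by (rule weak_grad_AE_eq[OF open_box g u periodic(2)])
    have "(\<lambda>n. L2_inner \<Omega> (X n) (\<lambda>x. 1)) \<longlonglongrightarrow> L2_inner \<Omega> u (\<lambda>x. 1)"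
      by (rule L2.ip_tendsto[OF XD(2) u one_L2 lim_u])
    then have "L2_inner \<Omega> u (\<lambda>x. 1) = 0"
      using XD(4) by (simp add: LIMSEQ_const_iff)
    with periodic(1) have uH: "u \<in> H_per a b" by (rule H_perI)
    have "dirichlet (X n - u) (X n - u) = L2_inner \<Omega> (grad (X n) - g) (grad (X n) - g)" for n
    proof -
      have d: "X n - u \<in> H_per a b" using X uH by simp
      have "AE x in lebesgue_on \<Omega>. grad (X n - u) x = (grad (X n) - g) x"
        using grad_diff[OF periodic(1) XD(1)[of n]] grad_u by eventually_elim simp
      then show ?thesis
        unfolding dirichlet_def using H_perD[OF d] XD g by (intro L2_inner_cong_AE) auto
    qed
    then have "(\<lambda>n. L2_inner \<Omega> (X n - u) (X n - u) + dirichlet (X n - u) (X n - u)) \<longlonglongrightarrow> 0"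
      using tendsto_add[OF lim_u lim_g] by simp
    then show "\<exists>u\<in>H_per a b. (\<lambda>n. L2_inner \<Omega> (X n - u) (X n - u) + dirichlet (X n - u) (X n - u)) \<longlonglongrightarrow> 0"
      using uH by blast
  qed (auto simp: m.bilin d.bilin m.sym d.sym algebra_simps m.nonneg d.nonneg subspace_H_per intro!: add_nonneg_nonneg)
qed

lemma weighted_form:
  assumes h: "h \<in> borel_measurable (lebesgue_on \<Omega>)" "AE x in lebesgue_on \<Omega>. \<bar>h x\<bar> \<le> C"
  shows "semi_inner_product (H_per a b) (\<lambda>u v. L2_inner \<Omega> (\<lambda>x. h x * u x) (\<lambda>x. h x * v x))"
proof -
  have L: "(\<lambda>x. h x * u x) \<in> L2 \<Omega>" if "u \<in> H_per a b" for u
    using L2_mult_Linf(1)[OF h] H_perD[OF that] by blast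
  have add: "(\<lambda>x. h x * (u + v) x) = (\<lambda>x. h x * u x) + (\<lambda>x. h x * v x)" for u v
    by (simp add: fun_eq_iff algebra_simps)
  have scale: "(\<lambda>x. h x * (c *\<^sub>R u) x) = c *\<^sub>R (\<lambda>x. h x * u x)" for c u
    by (simp add: fun_eq_iff)
  show ?thesis
    by unfold_locales
      (simp_all only: add scale L2.bilin L L2.nonneg subspace_H_per, rule L2.sym, simp_all only: L)
qed

end

theorem theorem3p2:
  fixes a b :: "real^'d"
    and M \<epsilon> \<delta>t A B V :: real
    and D :: "real set" and F f :: "real \<Rightarrow> real"
    and \<phi>_0 \<phi>_n \<phi>h U_n H_n :: "real^'d \<Rightarrow> real"
  assumes dim: "CARD('d) = 2 \<or> CARD('d) = 3"
    and nondegenerate: "\<forall>i. a $ i < b $ i"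
    and params: "M > 0" "\<epsilon> > 0" "\<delta>t > 0" "A > 0" "B > A"
    and domain: "\<forall>s\<in>D. s islimpt D"
    and F_deriv: "\<forall>s\<in>D. (F has_real_derivative f s) (at s within D)"
    and F_C1: "continuous_on D f"
    and F_bound: "\<forall>s\<in>D. F s > - A"
    and \<phi>_n_H1: "\<phi>_n \<in> H1_periodic a b"
    and \<phi>_n_domain: "AE x in lebesgue_on (box a b). \<phi>_n x \<in> D"
    and U_n_L2: "U_n \<in> L2 (box a b)"
    and H_n_def: "H_n = (\<lambda>x. H_fun F f B (\<phi>_n x))"
    and H_n_Linf: "H_n \<in> Linf (box a b)"
    and \<phi>_0_int: "integrable (lebesgue_on (box a b)) \<phi>_0"
    and V_def: "V = mean_value (box a b) \<phi>_0"
    and mean_conserved: "mean_value (box a b) \<phi>_0 = mean_value (box a b) \<phi>_n"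
    and \<phi>h_def: "\<phi>h = (\<lambda>x. \<phi>_n x - V)"
  shows "\<exists>w \<phi>. solves_system a b M \<epsilon> \<delta>t H_n U_n \<phi>h w \<phi> \<and>
           (\<forall>w' \<phi>'. solves_system a b M \<epsilon> \<delta>t H_n U_n \<phi>h w' \<phi>' \<longrightarrow>
              (AE x in lebesgue_on (box a b). w' x = w x \<and> \<phi>' x = \<phi> x))"
proof -
  interpret periodic_cell a b
    by unfold_locales (use nondegenerate in blast)
  obtain C where h: "H_n \<in> borel_measurable (lebesgue_on \<Omega>)" "AE x in lebesgue_on \<Omega>. \<bar>H_n x\<bar> \<le> C"
    using H_n_Linf by (auto simp: Linf_def)
  \<comment> \<open>Both right-hand sides are inner products with \<open>L\<^sup>2\<close> functions, as \<open>H_n\<close> is bounded.\<close>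
  define g where "g = (\<lambda>x. - H_n x * U_n x + 1 / 2 * H_n x * H_n x * \<phi>h x)"
  have hL: "(\<lambda>x. H_n x * u x) \<in> L2 \<Omega>" if "u \<in> L2 \<Omega>" for u
    using L2_mult_Linf(1)[OF h that] .
  have \<phi>h: "\<phi>h \<in> L2 \<Omega>"
  proof -
    have "\<phi>_n - V *\<^sub>R (\<lambda>x. 1) \<in> L2 \<Omega>"
      using H1_periodicD(1)[OF \<phi>_n_H1] one_L2 by simp
    also have "\<phi>_n - V *\<^sub>R (\<lambda>x. 1) = \<phi>h" by (simp add: \<phi>h_def fun_eq_iff)
    finally show ?thesis .
  qed
  have g: "g \<in> L2 \<Omega>"
  proof -
    have "(-1) *\<^sub>R (\<lambda>x. H_n x * U_n x) + (1 / 2) *\<^sub>R (\<lambda>x. H_n x * (H_n x * \<phi>h x)) \<in> L2 \<Omega>"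
      using hL[OF U_n_L2] hL[OF hL[OF \<phi>h]] by simp
    also have "(-1) *\<^sub>R (\<lambda>x. H_n x * U_n x) + (1 / 2) *\<^sub>R (\<lambda>x. H_n x * (H_n x * \<phi>h x)) = g"
      by (simp add: g_def fun_eq_iff)
    finally show ?thesis .
  qed
  interpret coupled_forms "H_per a b" "L2_inner \<Omega>" dirichlet
    "\<lambda>u v. L2_inner \<Omega> (\<lambda>x. H_n x * u x) (\<lambda>x. H_n x * v x)" "\<delta>t * M" "\<epsilon>\<^sup>2" "C\<^sup>2"
  proof (intro coupled_forms.intro mass_form dirichlet_form energy_complete weighted_form[OF h] coupled_forms_axioms.intro)
    show "L2_inner \<Omega> (\<lambda>x. H_n x * u x) (\<lambda>x. H_n x * u x) \<le> C\<^sup>2 * L2_inner \<Omega> u u" if "u \<in> H_per a b" for u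
      using L2_mult_Linf(2)[OF h] H_perD[OF that] by blast
  qed (use params in auto)
  have sys: "solves_system a b M \<epsilon> \<delta>t H_n U_n \<phi>h w \<phi> \<longleftrightarrow> solves (L2_inner \<Omega> \<phi>h) (L2_inner \<Omega> g) w \<phi>" for w \<phi>
  proof -
    have "L2_inner \<Omega> (\<lambda>x. - w x) \<psi> = - L2_inner \<Omega> w \<psi>" for \<psi>
      by (simp add: L2_inner_def)
    then show ?thesis
      by (simp add: solves_system_def solves_def dirichlet_def g_def)
  qed
  have "\<exists>w \<phi>. solves (L2_inner \<Omega> \<phi>h) (L2_inner \<Omega> g) w \<phi>"
  proof (rule exists_solution[where \<beta> = "L2.nrm \<Omega> \<phi>h" and \<gamma> = "L2.nrm \<Omega> g"])
    show "\<bar>L2_inner \<Omega> \<phi>h x\<bar> \<le> L2.nrm \<Omega> \<phi>h * m.nrm x" "\<bar>L2_inner \<Omega> g x\<bar> \<le> L2.nrm \<Omega> g * m.nrm x"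
      if "x \<in> H_per a b" for x
      using L2.Cauchy_Schwarz[OF \<phi>h H_perD(2)[OF that]] L2.Cauchy_Schwarz[OF g H_perD(2)[OF that]]
      by (simp_all add: m.nrm_def L2.nrm_def)
  qed (use \<phi>h g H_perD(2) in \<open>auto simp: L2.bilin\<close>)
  then obtain w \<phi> where sol: "solves (L2_inner \<Omega> \<phi>h) (L2_inner \<Omega> g) w \<phi>" by blast
  have "AE x in lebesgue_on \<Omega>. w' x = w x \<and> \<phi>' x = \<phi> x"
    if sol': "solves (L2_inner \<Omega> \<phi>h) (L2_inner \<Omega> g) w' \<phi>'" for w' \<phi>'
  proof -
    have "w \<in> L2 \<Omega>" "\<phi> \<in> L2 \<Omega>" "w' \<in> L2 \<Omega>" "\<phi>' \<in> L2 \<Omega>"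
      using sol sol' H_perD(2) by (auto simp: solves_def)
    then have "w' - w \<in> L2 \<Omega>" "\<phi>' - \<phi> \<in> L2 \<Omega>" by simp_all
    from L2_inner_self_eq_0[OF this(1) unique(1)[OF sol sol']] L2_inner_self_eq_0[OF this(2) unique(2)[OF sol sol']]
    show ?thesis by eventually_elim simp
  qed
  then show ?thesis
    unfolding sys using sol by blast
qed

end
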